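(* Let $k_G^{\mathbb{C}} := 4/\pi$. Then $k_G^{\mathbb{C}}$ is the smallest positive real number $k$ with the following property: for every natural number $n$ and every matrix $D \in \mathcal{D}_n$ there exists a matrix $R \in \mathcal{R}_n$ with $D \leq k R$.
   Context: For a natural number $n$, $M_n(\mathbb{C})$ denotes the complex $n\times n$ matrices and $I_n$ the identity matrix; $A \le B$ means that $B-A$ is positive semidefinite; $\mathrm{diag}(D)$ denotes the diagonal matrix with the same main diagonal as $D$. "Positive" matrix means positive semidefinite. $\mathcal{D}_n := \{D \in M_n(\mathbb{C}) : D \geq 0 \text{ and } \mathrm{diag}(D) \leq I_n\}$. $\mathcal{R}_n$ is the closed convex hull of the set of positive rank one matrices in $M_n(\mathbb{C})$ whose main diagonal is that of $I_n$ (all diagonal entries equal to 1). *)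

theory Defs
  imports "HOL-Analysis.Analysis" "Jordan_Normal_Form.DL_Rank"
begin

text \<open>
  On complex numbers, \<open>0 \<le> z\<close> says that \<open>z\<close> is real and nonnegative, so the
  condition below contains the self-adjointness of \<open>A\<close>.
\<close>

definition positive_semidef :: "nat \<Rightarrow> complex mat \<Rightarrow> bool" where
  "positive_semidef n A \<longleftrightarrow>
     A \<in> carrier_mat n n \<and> (\<forall>v \<in> carrier_vec n. 0 \<le> (A *\<^sub>v v) \<bullet>c v)"

text \<open>The order \<open>\<le>\<close> that the library puts on matrices is entrywise and is not used here.\<close>

definition loewner_le :: "nat \<Rightarrow> complex mat \<Rightarrow> complex mat \<Rightarrow> bool" where
  "loewner_le n A B \<longleftrightarrow>
     A \<in> carrier_mat n n \<and> B \<in> carrier_mat n n \<and> positive_semidef n (B - A)"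

definition diag_part :: "nat \<Rightarrow> complex mat \<Rightarrow> complex mat" where
  "diag_part n A = mat_diag n (\<lambda>i. A $$ (i, i))"

definition D_set :: "nat \<Rightarrow> complex mat set" where
  "D_set n = {D. positive_semidef n D \<and> loewner_le n (diag_part n D) (1\<^sub>m n)}"

text \<open>
  Matrices of a given size do not form a type, so convexity and the usual topology of
  \<open>M\<^sub>n(\<complex>)\<close> (that of \<open>\<complex>\<close> to the power \<open>n\<^sup>2\<close>, via the matrix entries) are
  stated relative to \<^term>\<open>carrier_mat n n\<close>.
\<close>

definition mat_convex :: "complex mat set \<Rightarrow> bool" where
  "mat_convex T \<longleftrightarrow>
     (\<forall>A\<in>T. \<forall>B\<in>T. \<forall>u\<ge>0. \<forall>v\<ge>0. u + v = 1 \<longrightarrow>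
        complex_of_real u \<cdot>\<^sub>m A + complex_of_real v \<cdot>\<^sub>m B \<in> T)"

definition mat_topology :: "nat \<Rightarrow> complex mat topology" where
  "mat_topology n =
     pullback_topology (carrier_mat n n)
       (\<lambda>A. \<lambda>ij \<in> {..<n} \<times> {..<n}. A $$ ij)
       (product_topology (\<lambda>_. euclidean) ({..<n} \<times> {..<n}))"

definition closed_convex_hull :: "nat \<Rightarrow> complex mat set \<Rightarrow> complex mat set" where
  "closed_convex_hull n S = (\<lambda>T. closedin (mat_topology n) T \<and> mat_convex T) hull S"

definition R_set :: "nat \<Rightarrow> complex mat set" where
  "R_set n = closed_convex_hull n
     {A. positive_semidef n A \<and> vec_space.rank n A = 1 \<and> diag_part n A = 1\<^sub>m n}"

definition k_G_complex :: real where
  "k_G_complex = 4 / pi"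

text \<open>
  The size \<open>n = 0\<close> is excluded: there is no matrix of size 0 and rank one, so
  \<^term>\<open>R_set 0\<close> is empty while \<^term>\<open>D_set 0\<close> is not.
\<close>

definition dominating_constant :: "real \<Rightarrow> bool" where
  "dominating_constant k \<longleftrightarrow>
     (\<forall>n\<ge>1. \<forall>D \<in> D_set n. \<exists>R \<in> R_set n. loewner_le n D (complex_of_real k \<cdot>\<^sub>m R))"

end

theory Submission
  imports Defs "HOL-Probability.Probability" "HOL-Real_Asymp.Real_Asymp"
begin

text \<open>
  Let \<open>c = E |g| = \<surd>\<pi>/2\<close> for a complex Gaussian variable \<open>g\<close> with \<open>E |g|\<^sup>2 = 1\<close>, so that the
  constant is \<open>1/c\<^sup>2\<close>. Both halves rest on the rotation invariance of a Gaussian vector: a linear form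
  with coefficients \<open>v\<close> has mean modulus \<open>c |v|\<close> (lemma \<open>gaussian_form_abs\<close>).

  The constant suffices because of a rounding procedure (lemma \<open>little_grothendieck\<close>). A matrix \<open>D\<close> with unit
  diagonal is the covariance matrix of Gaussian variables \<open>z i\<close> that are linear forms with
  unit coefficient vectors. Replacing them by their phases \<open>s i\<close> gives a matrix \<open>R = E s s\<^sup>*\<close> in the
  closed convex hull. Differentiating \<open>c |v|\<close> yields the correlation \<open>c\<close> times the inner product
  between a phase and a Gaussian form (lemma \<open>gaussian_form_phase_correlation\<close>). So, among the
  real multiples of \<open>W\<close>, a combination of the \<open>z i\<close>, the multiple \<open>c W\<close> is the orthogonal projection of the same
  combination \<open>Y\<close> of the phases, and \<open>E |Y|\<^sup>2 \<ge> c\<^sup>2 E |W|\<^sup>2\<close> means \<open>R \<ge> c\<^sup>2 D\<close>.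

  No smaller constant suffices because in high dimension the length of a Gaussian vector is nearly
  constant. The Gram matrix of the normalized values of such a vector, paired with the Gram matrix
  of the values themselves, gives at least a quantity tending to \<open>1\<close> (lemma
  \<open>expectation_gaussian_norm_ge\<close>), whereas every generator of the hull gives at most \<open>c\<^sup>2\<close>, again by
  the mean modulus of the forms. Finitely many weighted points replace the Gaussian vector (lemma
  \<open>gaussian_discretization\<close>), which gives finite matrices (lemma
  \<open>dominating_constant_lower_bound\<close>).
\<close>

section \<open>Gaussian linear forms\<close>

text \<open>
  Two real coordinates, indexed by \<open>False\<close> and \<open>True\<close>, serve as real and imaginary part of
  each complex Gaussian variable. All coordinates live on one infinite product, so that the
  dimension can vary without a change of the probability space.
\<close>

definition gaussian_space :: "(nat \<times> bool \<Rightarrow> real) measure" where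
  "gaussian_space = PiM UNIV (\<lambda>_. density lborel std_normal_density)"

interpretation gauss: prob_space gaussian_space
  unfolding gaussian_space_def by (intro prob_space_PiM prob_space_normal_density) simp

lemma measurable_gaussian_coordinate [measurable]: "(\<lambda>\<omega>. \<omega> i) \<in> borel_measurable gaussian_space"
proof -
  have "(\<lambda>\<omega>. \<omega> i) \<in> measurable gaussian_space (density lborel std_normal_density)"
    unfolding gaussian_space_def by (rule measurable_component_singleton) simp
  then show ?thesis by simp
qed

lemma gaussian_coordinate_distributed:
  "distributed gaussian_space lborel (\<lambda>\<omega>. \<omega> i) std_normal_density"
proof -
  have "distr gaussian_space (density lborel std_normal_density) (\<lambda>\<omega>. \<omega> i) = density lborel std_normal_density"
    unfolding gaussian_space_def
    by (rule distr_PiM_component) (auto intro: prob_space_normal_density)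
  moreover have "distr gaussian_space (density lborel std_normal_density) (\<lambda>\<omega>. \<omega> i) = distr gaussian_space lborel (\<lambda>\<omega>. \<omega> i)"
    by (rule distr_cong) auto
  ultimately show ?thesis
    unfolding distributed_def by simp
qed

lemma gaussian_coordinates_indep: "gauss.indep_vars (\<lambda>_. borel) (\<lambda>i \<omega>. \<omega> i) UNIV"
proof -
  have "distr gaussian_space (PiM UNIV (\<lambda>_. density lborel std_normal_density)) (\<lambda>\<omega>. \<lambda>i\<in>UNIV. \<omega> i) =
      PiM UNIV (\<lambda>i. distr gaussian_space (density lborel std_normal_density) (\<lambda>\<omega>. \<omega> i))"
    unfolding gaussian_space_def
    by (subst distr_PiM_component) (auto intro: prob_space_normal_density simp: distr_id restrict_UNIV)
  then have "gauss.indep_vars (\<lambda>_. density lborel std_normal_density) (\<lambda>i \<omega>. \<omega> i) UNIV"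
    by (subst gauss.indep_vars_iff_distr_eq_PiM') auto
  from gauss.indep_vars_compose2[OF this, of "\<lambda>i x. x"  "\<lambda>_. borel"]
  show ?thesis by simp
qed

text \<open>
  Vanishing coefficients have to be dropped before independent normal variables are added up,
  because a normal density needs a positive standard deviation.
\<close>

lemma gaussian_combination_distributed:
  assumes "finite I" and "(\<Sum>i\<in>I. (a i)\<^sup>2) > 0"
  shows "distributed gaussian_space lborel (\<lambda>\<omega>. \<Sum>i\<in>I. a i * \<omega> i)
           (normal_density 0 (sqrt (\<Sum>i\<in>I. (a i)\<^sup>2)))"
proof -
  define J where "J = {i\<in>I. a i \<noteq> 0}"
  have J: "finite J" "J \<noteq> {}" "J \<subseteq> I"
  proof -
    show "J \<noteq> {}"
    proof
      assume "J = {}"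
      then have "(\<Sum>i\<in>I. (a i)\<^sup>2) = 0" unfolding J_def by (intro sum.neutral) auto
      then show False using assms by simp
    qed
  qed (auto simp: J_def assms)
  have s1: "(\<Sum>i\<in>I. a i * \<omega> i) = (\<Sum>i\<in>J. a i * \<omega> i)" for \<omega>
    using assms J by (intro sum.mono_neutral_right) (auto simp: J_def)
  have s2: "(\<Sum>i\<in>I. (a i)\<^sup>2) = (\<Sum>i\<in>J. (a i)\<^sup>2)"
    using assms J by (intro sum.mono_neutral_right) (auto simp: J_def)
  have ind: "gauss.indep_vars (\<lambda>_. borel) (\<lambda>i \<omega>. a i * \<omega> i) J"
    using gauss.indep_vars_compose2[OF gauss.indep_vars_subset[OF gaussian_coordinates_indep, of J],
        of "\<lambda>i x. a i * x" "\<lambda>_. borel"] by simp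
  have "distributed gaussian_space lborel (\<lambda>\<omega>. a i * \<omega> i) (normal_density 0 \<bar>a i\<bar>)" if "i \<in> J" for i
    using gauss.normal_density_affine[OF gaussian_coordinate_distributed, of "a i" 0] that
    by (simp add: J_def)
  from gauss.sum_indep_normal[OF J(1,2) ind _ this] show ?thesis
    unfolding s1 s2 by (simp add: J_def)
qed

lemma gaussian_combination_moments:
  fixes a :: "nat \<times> bool \<Rightarrow> real"
  assumes "finite I"
  defines "\<sigma> \<equiv> sqrt (\<Sum>i\<in>I. (a i)\<^sup>2)" and "S \<equiv> \<lambda>\<omega>. \<Sum>i\<in>I. a i * \<omega> i"
  shows "has_bochner_integral gaussian_space (\<lambda>\<omega>. \<bar>S \<omega>\<bar>) (sqrt (2 / pi) * \<sigma>)"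
    and "has_bochner_integral gaussian_space (\<lambda>\<omega>. (S \<omega>)\<^sup>2) (\<sigma>\<^sup>2)"
    and "has_bochner_integral gaussian_space (\<lambda>\<omega>. (S \<omega>) ^ 4) (3 * \<sigma> ^ 4)"
proof -
  have "has_bochner_integral gaussian_space (\<lambda>\<omega>. \<bar>S \<omega>\<bar>) (sqrt (2 / pi) * \<sigma>) \<and>
      has_bochner_integral gaussian_space (\<lambda>\<omega>. (S \<omega>)\<^sup>2) (\<sigma>\<^sup>2) \<and>
      has_bochner_integral gaussian_space (\<lambda>\<omega>. (S \<omega>) ^ 4) (3 * \<sigma> ^ 4)"
  proof (cases "(\<Sum>i\<in>I. (a i)\<^sup>2) = 0")
    case True
    then have "\<And>i. i \<in> I \<Longrightarrow> a i = 0" using assms(1) by (simp add: sum_nonneg_eq_0_iff)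
    then have "S = (\<lambda>\<omega>. 0)" by (auto simp: S_def intro!: sum.neutral)
    then show ?thesis using True by (simp add: \<sigma>_def has_bochner_integral_zero)
  next
    case False
    then have pos: "(\<Sum>i\<in>I. (a i)\<^sup>2) > 0"
      by (simp add: order_less_le sum_nonneg)
    then have \<sigma>: "0 < \<sigma>" by (simp add: \<sigma>_def)
    have D: "distributed gaussian_space lborel S (normal_density 0 \<sigma>)"
      unfolding S_def \<sigma>_def by (rule gaussian_combination_distributed[OF assms(1) pos])
    have push: "has_bochner_integral gaussian_space (\<lambda>\<omega>. f (S \<omega>)) r"
      if "has_bochner_integral lborel (\<lambda>x. normal_density 0 \<sigma> x * f x) r" "f \<in> borel_measurable borel"
      for f :: "real \<Rightarrow> real" and r
      using that distributed_integral[OF D, of f] distributed_integrable[OF D, of f]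
      by (auto simp: has_bochner_integral_iff)
    have "fact 4 / ((2 / \<sigma>\<^sup>2)\<^sup>2 * fact 2) = 3 * \<sigma> ^ 4" "fact 2 / (2 / \<sigma>\<^sup>2) = \<sigma>\<^sup>2"
      by (auto simp: fact_numeral power2_eq_square field_simps eval_nat_numeral)
    then show ?thesis
      using push[OF normal_moment_abs_odd[OF \<sigma>, of 0 0, simplified]]
        push[OF normal_moment_even[OF \<sigma>, of 0 1, simplified]]
        push[OF normal_moment_even[OF \<sigma>, of 0 2, simplified]]
      by (simp add: mult.commute)
  qed
  then show "has_bochner_integral gaussian_space (\<lambda>\<omega>. \<bar>S \<omega>\<bar>) (sqrt (2 / pi) * \<sigma>)"
    and "has_bochner_integral gaussian_space (\<lambda>\<omega>. (S \<omega>)\<^sup>2) (\<sigma>\<^sup>2)"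
    and "has_bochner_integral gaussian_space (\<lambda>\<omega>. (S \<omega>) ^ 4) (3 * \<sigma> ^ 4)"
    by blast+
qed

text \<open>
  A modulus is an average of absolute values of real parts over all rotations; half a turn is
  enough, because opposite rotations give the same absolute value. This reduces absolute moments of complex Gaussian variables to those of real ones, so that the joint
  distribution of real and imaginary part is never needed. Since a sign change of \<open>z\<close> does not
  matter, its argument may be taken in \<open>[-\<pi>/2, \<pi>/2]\<close>, where the sign of the cosine changes only
  once in the range of integration.
\<close>

lemma integral_abs_Re_rotation:
  fixes z :: complex
  shows "((\<lambda>\<theta>. \<bar>Re (cis \<theta> * z)\<bar>) has_integral 2 * cmod z) {0..pi}"
proof -
  have main: "((\<lambda>\<theta>. \<bar>Re (cis \<theta> * z)\<bar>) has_integral 2 * cmod z) {0..pi}" if z: "0 \<le> Re z" for z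
  proof -
    define \<phi> where "\<phi> = (if z = 0 then 0 else Arg z)"
    have \<phi>: "-(pi/2) \<le> \<phi>" "\<phi> \<le> pi/2"
      using z Arg_Re_nonneg[of z] by (auto simp: \<phi>_def abs_le_iff)
    have zc: "z = cmod z * cis \<phi>"
      by (metis \<phi>_def mult_zero_left norm_zero of_real_0 rcis_cmod_Arg rcis_def)
    have re: "Re (cis \<theta> * z) = cmod z * cos (\<theta> + \<phi>)" for \<theta>
      by (subst zc) (simp add: cos_add algebra_simps)
    have 1: "((\<lambda>\<theta>. cos (\<theta> + \<phi>)) has_integral (sin (pi/2 - \<phi> + \<phi>) - sin (0 + \<phi>))) {0..pi/2 - \<phi>}"
      using \<phi> by (intro fundamental_theorem_of_calculus)
        (auto intro!: derivative_eq_intros simp: has_real_derivative_iff_has_vector_derivative[symmetric])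
    have 2: "((\<lambda>\<theta>. - cos (\<theta> + \<phi>)) has_integral (- sin (pi + \<phi>) - - sin (pi/2 - \<phi> + \<phi>))) {pi/2 - \<phi>..pi}"
      using \<phi> by (intro fundamental_theorem_of_calculus)
        (auto intro!: derivative_eq_intros simp: has_real_derivative_iff_has_vector_derivative[symmetric])
    have 1: "((\<lambda>\<theta>. \<bar>cos (\<theta> + \<phi>)\<bar>) has_integral (1 - sin \<phi>)) {0..pi/2 - \<phi>}"
      using 1 \<phi> by (subst has_integral_cong[where g="\<lambda>\<theta>. cos (\<theta> + \<phi>)"]) (auto intro!: abs_of_nonneg cos_ge_zero)
    have "cos (\<theta> + \<phi>) \<le> 0" if "\<theta> \<in> {pi/2 - \<phi>..pi}" for \<theta>
    proof -
      have "0 \<le> cos (\<theta> + \<phi> - pi)" using that \<phi> by (intro cos_ge_zero) auto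
      then show ?thesis by (simp add: cos_diff)
    qed
    then have 2: "((\<lambda>\<theta>. \<bar>cos (\<theta> + \<phi>)\<bar>) has_integral (sin \<phi> + 1)) {pi/2 - \<phi>..pi}"
      using 2 \<phi> by (subst has_integral_cong[where g="\<lambda>\<theta>. - cos (\<theta> + \<phi>)"]) (auto intro!: abs_of_nonpos simp: sin_add)
    have "((\<lambda>\<theta>. \<bar>cos (\<theta> + \<phi>)\<bar>) has_integral ((1 - sin \<phi>) + (sin \<phi> + 1))) {0..pi}"
      using \<phi> by (intro has_integral_combine[OF _ _ 1 2]) auto
    then have "((\<lambda>\<theta>. cmod z * \<bar>cos (\<theta> + \<phi>)\<bar>) has_integral (cmod z * 2)) {0..pi}"
      by (intro has_integral_mult_right) simp
    then show ?thesis
      by (simp only: re abs_mult abs_norm_cancel mult.commute[of 2])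
  qed
  show ?thesis
  proof (cases "0 \<le> Re z")
    case True then show ?thesis by (rule main)
  next
    case False
    then have "((\<lambda>\<theta>. \<bar>Re (cis \<theta> * (- z))\<bar>) has_integral 2 * cmod (- z)) {0..pi}"
      by (intro main) simp
    moreover have "\<bar>Re (cis \<theta> * (- z))\<bar> = \<bar>Re (cis \<theta> * z)\<bar>" for \<theta>
      by (metis abs_minus_cancel mult_minus_right uminus_complex.simps(1))
    ultimately show ?thesis by simp
  qed
qed

definition complex_gaussian :: "nat \<Rightarrow> (nat \<times> bool \<Rightarrow> real) \<Rightarrow> complex" where
  "complex_gaussian l \<omega> = Complex (\<omega> (l, False)) (\<omega> (l, True)) / complex_of_real (sqrt 2)"

definition gaussian_form :: "nat \<Rightarrow> (nat \<Rightarrow> complex) \<Rightarrow> (nat \<times> bool \<Rightarrow> real) \<Rightarrow> complex" where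
  "gaussian_form d v \<omega> = (\<Sum>l<d. v l * complex_gaussian l \<omega>)"

abbreviation l2norm :: "nat \<Rightarrow> (nat \<Rightarrow> complex) \<Rightarrow> real" where
  "l2norm d v \<equiv> L2_set (\<lambda>l. cmod (v l)) {..<d}"

lemma gaussian_form_add: "gaussian_form d (\<lambda>l. u l + v l) \<omega> = gaussian_form d u \<omega> + gaussian_form d v \<omega>"
  by (simp add: gaussian_form_def sum.distrib algebra_simps add_divide_distrib)

lemma gaussian_form_scale: "gaussian_form d (\<lambda>l. a * v l) \<omega> = a * gaussian_form d v \<omega>"
  by (simp add: gaussian_form_def sum_distrib_left algebra_simps)

lemma measurable_complex_gaussian [measurable]: "complex_gaussian l \<in> borel_measurable gaussian_space"
  unfolding complex_gaussian_def Complex_eq by measurable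

lemma measurable_gaussian_form [measurable]: "gaussian_form d v \<in> borel_measurable gaussian_space"
  unfolding gaussian_form_def by measurable

lemma Re_gaussian_form:
  "Re (gaussian_form d v \<omega>) = (\<Sum>(l,b)\<in>{..<d} \<times> UNIV. (if b then - Im (v l) else Re (v l)) / sqrt 2 * \<omega> (l, b))"
  by (simp add: gaussian_form_def complex_gaussian_def sum.cartesian_product[symmetric] UNIV_bool
      Complex_eq Re_divide_of_real diff_divide_distrib algebra_simps)

lemma Re_gaussian_form_moments:
  shows "has_bochner_integral gaussian_space (\<lambda>\<omega>. \<bar>Re (gaussian_form d v \<omega>)\<bar>) (l2norm d v / sqrt pi)"
    and "has_bochner_integral gaussian_space (\<lambda>\<omega>. (Re (gaussian_form d v \<omega>))\<^sup>2) ((l2norm d v)\<^sup>2 / 2)"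
proof -
  define a where "a = (\<lambda>(l,b). (if b then - Im (v l) else Re (v l)) / sqrt 2)"
  have re: "Re (gaussian_form d v \<omega>) = (\<Sum>i\<in>{..<d} \<times> UNIV. a i * \<omega> i)" for \<omega>
    by (simp add: Re_gaussian_form a_def split_def)
  have split: "(\<Sum>i\<in>{..<d} \<times> UNIV. f i) = (\<Sum>l<d. f (l, False) + f (l, True))" for f :: "nat \<times> bool \<Rightarrow> real"
    using sum.cartesian_product[of "\<lambda>l b. f (l, b)" UNIV "{..<d}"] by (simp add: UNIV_bool add.commute)
  have "(\<Sum>i\<in>{..<d} \<times> UNIV. (a i)\<^sup>2) = (\<Sum>l<d. (cmod (v l))\<^sup>2) / 2"
    unfolding split by (simp add: a_def cmod_power2 power_divide sum_divide_distrib add_divide_distrib)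
  then have \<sigma>: "sqrt (\<Sum>i\<in>{..<d} \<times> UNIV. (a i)\<^sup>2) = l2norm d v / sqrt 2"
    by (simp only: L2_set_def real_sqrt_divide)
  have e1: "sqrt (2 / pi) * (l2norm d v / sqrt 2) = l2norm d v / sqrt pi"
    by (simp add: real_sqrt_divide)
  have e2: "(l2norm d v / sqrt 2)\<^sup>2 = (l2norm d v)\<^sup>2 / 2"
    by (simp add: power_divide)
  note moments = gaussian_combination_moments[of "{..<d} \<times> UNIV" a, unfolded \<sigma> e1 e2]
  show "has_bochner_integral gaussian_space (\<lambda>\<omega>. \<bar>Re (gaussian_form d v \<omega>)\<bar>) (l2norm d v / sqrt pi)"
    unfolding re by (rule moments) simp
  show "has_bochner_integral gaussian_space (\<lambda>\<omega>. (Re (gaussian_form d v \<omega>))\<^sup>2) ((l2norm d v)\<^sup>2 / 2)"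
    unfolding re by (rule moments) simp
qed

lemma l2norm_square: "(l2norm d v)\<^sup>2 = (\<Sum>l<d. (cmod (v l))\<^sup>2)"
  by (simp add: L2_set_def sum_nonneg)

lemma l2norm_scale: "l2norm d (\<lambda>l. a * v l) = cmod a * l2norm d v"
  by (simp add: norm_mult L2_set_right_distrib)

lemma gaussian_form_square:
  "has_bochner_integral gaussian_space (\<lambda>\<omega>. (cmod (gaussian_form d v \<omega>))\<^sup>2) ((l2norm d v)\<^sup>2)"
proof -
  have "Re (gaussian_form d (\<lambda>l. - \<i> * v l) \<omega>) = Im (gaussian_form d v \<omega>)" for \<omega>
    by (subst gaussian_form_scale) simp
  then have "has_bochner_integral gaussian_space (\<lambda>\<omega>. (Im (gaussian_form d v \<omega>))\<^sup>2) ((l2norm d v)\<^sup>2 / 2)"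
    using Re_gaussian_form_moments(2)[of d "\<lambda>l. - \<i> * v l"] by (subst (asm) l2norm_scale) simp
  from has_bochner_integral_add[OF Re_gaussian_form_moments(2)[of d v] this]
  show ?thesis by (simp add: cmod_power2)
qed

text \<open>
  The first absolute moment depends on the length of \<open>v\<close> alone: after the modulus is written as an
  average over rotations and the integrals are exchanged, each rotation only turns \<open>v\<close> into a vector
  of the same length, and the real part of its form is a real normal variable. The constant
  \<open>\<surd>\<pi>/2\<close> is the one whose inverse square is \<open>4/\<pi>\<close>.
\<close>

lemma gaussian_form_abs:
  "has_bochner_integral gaussian_space (\<lambda>\<omega>. cmod (gaussian_form d v \<omega>)) (sqrt pi / 2 * l2norm d v)"
proof (rule has_bochner_integral_nn_integral)
  interpret P: pair_sigma_finite gaussian_space lborel ..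
  let ?f = "\<lambda>\<theta> \<omega>. ennreal \<bar>Re (cis \<theta> * gaussian_form d v \<omega>)\<bar> * indicator {0..pi} \<theta>"
  have cis_meas [measurable]: "cis \<in> borel_measurable borel"
    by (intro borel_measurable_continuous_onI continuous_intros)
  have circle: "(\<integral>\<^sup>+\<theta>. ennreal \<bar>Re (cis \<theta> * z)\<bar> * indicator {0..pi} \<theta> \<partial>lborel) = ennreal (2 * cmod z)" for z
    by (rule nn_integral_has_integral_lebesgue'[OF _ integral_abs_Re_rotation]) auto
  have rot: "(\<integral>\<^sup>+\<omega>. ?f \<theta> \<omega> \<partial>gaussian_space) = ennreal (l2norm d v / sqrt pi) * indicator {0..pi} \<theta>" for \<theta>
  proof -
    have "cis \<theta> * gaussian_form d v \<omega> = gaussian_form d (\<lambda>l. cis \<theta> * v l) \<omega>" for \<omega>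
      by (simp add: gaussian_form_scale)
    then have "has_bochner_integral gaussian_space (\<lambda>\<omega>. \<bar>Re (cis \<theta> * gaussian_form d v \<omega>)\<bar>) (l2norm d v / sqrt pi)"
      using Re_gaussian_form_moments(1)[of d "\<lambda>l. cis \<theta> * v l"] by (simp add: norm_mult)
    then show ?thesis
      by (subst nn_integral_multc) (auto simp: has_bochner_integral_iff nn_integral_eq_integral)
  qed
  have "2 * (\<integral>\<^sup>+\<omega>. ennreal (cmod (gaussian_form d v \<omega>)) \<partial>gaussian_space)
      = (\<integral>\<^sup>+\<omega>. \<integral>\<^sup>+\<theta>. ?f \<theta> \<omega> \<partial>lborel \<partial>gaussian_space)"
    unfolding circle by (simp add: nn_integral_cmult ennreal_mult')
  also have "\<dots> = (\<integral>\<^sup>+\<theta>. \<integral>\<^sup>+\<omega>. ?f \<theta> \<omega> \<partial>gaussian_space \<partial>lborel)"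
    by (rule P.Fubini'[symmetric]) measurable
  also have "\<dots> = ennreal (l2norm d v / sqrt pi) * ennreal pi"
    unfolding rot by (simp add: nn_integral_cmult_indicator)
  also have "\<dots> = ennreal (2 * (sqrt pi / 2 * l2norm d v))"
    by (simp add: ennreal_mult'[symmetric] real_div_sqrt field_simps)
  also have "\<dots> = 2 * ennreal (sqrt pi / 2 * l2norm d v)"
    by (subst ennreal_mult') simp_all
  finally show "(\<integral>\<^sup>+\<omega>. ennreal (cmod (gaussian_form d v \<omega>)) \<partial>gaussian_space) = ennreal (sqrt pi / 2 * l2norm d v)"
    by (simp add: ennreal_mult_cancel_left)
qed auto

lemma integrable_gaussian_form [simp]: "integrable gaussian_space (gaussian_form d v)"
  by (rule integrable_norm_cancel[OF integrable.intros[OF gaussian_form_abs]]) simp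

text \<open>
  The value \<open>1\<close> at \<open>0\<close> keeps the phase unimodular everywhere.
\<close>

definition unit_phase :: "complex \<Rightarrow> complex" where
  "unit_phase z = (if z = 0 then 1 else sgn z)"

lemma norm_unit_phase [simp]: "cmod (unit_phase z) = 1"
  by (simp add: unit_phase_def norm_sgn)

lemma cnj_unit_phase_times: "cnj (unit_phase z) * z = complex_of_real (cmod z)"
  by (auto simp: unit_phase_def sgn_eq complex_norm_square[symmetric] power2_eq_square divide_simps mult.commute)

lemma measurable_cnj [measurable]: "cnj \<in> borel_measurable borel"
  by (intro borel_measurable_continuous_onI continuous_intros)

lemma measurable_unit_phase [measurable]: "unit_phase \<in> borel_measurable borel"
  unfolding unit_phase_def sgn_eq by measurable

lemma has_bochner_integral_mono:
  fixes f g :: "'a \<Rightarrow> real"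
  assumes "has_bochner_integral M f a" "has_bochner_integral M g b" "\<And>x. f x \<le> g x"
  shows "a \<le> b"
  using integral_mono[of M f g] assms by (simp add: has_bochner_integral_iff)

lemma linear_le_quadratic_imp_zero:
  fixes a b :: real
  assumes "\<And>t. t * a \<le> t\<^sup>2 * b"
  shows "a = 0"
proof (rule ccontr)
  assume "a \<noteq> 0"
  \<comment> \<open>The choice makes \<open>s * a\<close> equal to \<open>s\<^sup>2 * (1 + \<bar>b\<bar>)\<close>.\<close>
  define s where "s = a / (1 + \<bar>b\<bar>)"
  have "s * a \<le> s\<^sup>2 * b" by (rule assms)
  also have "\<dots> \<le> s\<^sup>2 * \<bar>b\<bar>" by (intro mult_left_mono) auto
  also have "\<dots> < s\<^sup>2 * (1 + \<bar>b\<bar>)"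
    using \<open>a \<noteq> 0\<close> by (intro mult_strict_left_mono) (auto simp: s_def)
  also have "\<dots> = s * a" by (simp add: s_def power2_eq_square)
  finally show False by simp
qed

lemma l2norm_add_square:
  fixes t :: real
  shows "(l2norm d (\<lambda>l. v l + complex_of_real t * w l))\<^sup>2 =
    (l2norm d v)\<^sup>2 + 2 * t * Re (\<Sum>l<d. w l * cnj (v l)) + t\<^sup>2 * (l2norm d w)\<^sup>2"
proof -
  have "(cmod (v l + complex_of_real t * w l))\<^sup>2 =
      (cmod (v l))\<^sup>2 + 2 * t * Re (w l * cnj (v l)) + t\<^sup>2 * (cmod (w l))\<^sup>2" for l
    unfolding cmod_power2 by (simp add: power2_eq_square algebra_simps)
  then show ?thesis
    unfolding l2norm_square Re_sum by (simp only: sum.distrib sum_distrib_left)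
qed

text \<open>
  This is the derivative of the first absolute moment \<open>\<surd>\<pi>/2 * |v|\<close> at \<open>v\<close> in the direction \<open>w\<close>. No
  differentiation under the integral is needed: the modulus is convex, and
  \<open>|z + t w| \<ge> |z| + t Re (cnj (phase z) w)\<close>, so taking expectations bounds \<open>t\<close> times the difference of the two
  sides by a multiple of \<open>t\<^sup>2\<close>, for both signs of \<open>t\<close>.
\<close>

lemma gaussian_form_phase_correlation:
  assumes v: "l2norm d v = 1"
  shows "has_bochner_integral gaussian_space
     (\<lambda>\<omega>. Re (cnj (unit_phase (gaussian_form d v \<omega>)) * gaussian_form d w \<omega>))
     (sqrt pi / 2 * Re (\<Sum>l<d. w l * cnj (v l)))"
proof -
  let ?s = "\<lambda>\<omega>. unit_phase (gaussian_form d v \<omega>)"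
  let ?F = "\<lambda>\<omega>. Re (cnj (?s \<omega>) * gaussian_form d w \<omega>)"
  define \<beta> where "\<beta> = Re (\<Sum>l<d. w l * cnj (v l))"
  have int: "integrable gaussian_space ?F"
  proof (rule Bochner_Integration.integrable_bound[OF integrable_gaussian_form[of d w]])
    show "AE \<omega> in gaussian_space. norm (?F \<omega>) \<le> norm (gaussian_form d w \<omega>)"
    proof (rule AE_I2)
      fix \<omega>
      have "\<bar>?F \<omega>\<bar> \<le> cmod (cnj (?s \<omega>) * gaussian_form d w \<omega>)" by (rule abs_Re_le_cmod)
      then show "norm (?F \<omega>) \<le> norm (gaussian_form d w \<omega>)" by (simp add: norm_mult)
    qed
  qed measurable
  define m where "m = (\<integral>\<omega>. ?F \<omega> \<partial>gaussian_space)"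
  have "t * (m - sqrt pi / 2 * \<beta>) \<le> t\<^sup>2 * (sqrt pi / 4 * (l2norm d w)\<^sup>2)" for t
  proof -
    let ?u = "\<lambda>l. v l + complex_of_real t * w l"
    have "cmod (gaussian_form d v \<omega>) + t * ?F \<omega> \<le> cmod (gaussian_form d ?u \<omega>)" for \<omega>
    proof -
      have "cmod (gaussian_form d v \<omega>) + t * ?F \<omega>
          = Re (cnj (?s \<omega>) * (gaussian_form d v \<omega> + complex_of_real t * gaussian_form d w \<omega>))"
        using arg_cong[OF cnj_unit_phase_times[of "gaussian_form d v \<omega>"], of Re]
        by (simp add: algebra_simps)
      also have "\<dots> \<le> cmod (cnj (?s \<omega>) * (gaussian_form d v \<omega> + complex_of_real t * gaussian_form d w \<omega>))"
        by (rule complex_Re_le_cmod)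
      also have "\<dots> = cmod (gaussian_form d ?u \<omega>)"
        by (simp add: norm_mult gaussian_form_add gaussian_form_scale)
      finally show ?thesis .
    qed
    moreover have "has_bochner_integral gaussian_space (\<lambda>\<omega>. cmod (gaussian_form d v \<omega>) + t * ?F \<omega>)
        (sqrt pi / 2 * 1 + t * m)"
      using int gaussian_form_abs[of d v] unfolding v m_def
      by (intro has_bochner_integral_add has_bochner_integral_mult_right has_bochner_integral_integrable)
    ultimately have "sqrt pi / 2 * 1 + t * m \<le> sqrt pi / 2 * l2norm d ?u"
      using has_bochner_integral_mono[OF _ gaussian_form_abs[of d ?u]] by blast
    also have "l2norm d ?u \<le> 1 + (2 * t * \<beta> + t\<^sup>2 * (l2norm d w)\<^sup>2) / 2"
    proof -
      have le: "x \<le> 1 + y / 2" if "x\<^sup>2 = 1 + y" for x y :: real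
        using that sum_squares_bound[of 1 x] by simp
      show ?thesis
        by (rule le) (use l2norm_add_square[where d=d and v=v and t=t and w=w] v in \<open>simp add: \<beta>_def\<close>)
    qed
    finally show ?thesis by (simp add: field_simps)
  qed
  from linear_le_quadratic_imp_zero[OF this] have "m = sqrt pi / 2 * \<beta>" by simp
  then show ?thesis using int by (simp add: has_bochner_integral_iff m_def \<beta>_def)
qed

section \<open>The length of a Gaussian vector\<close>

text \<open>
  The mixed moments come from the fourth moments of \<open>\<omega> i + \<omega> j\<close> and \<open>\<omega> i - \<omega> j\<close> by polarization.
\<close>

lemma gaussian_square_product:
  "has_bochner_integral gaussian_space (\<lambda>\<omega>. (\<omega> i)\<^sup>2 * (\<omega> j)\<^sup>2) (if i = j then 3 else 1)"
proof (cases "i = j")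
  case True
  then show ?thesis
    using gaussian_combination_moments(3)[of "{i}" "\<lambda>_. 1"] by (simp add: power_mult_distrib power4_eq_xxxx power2_eq_square mult.assoc)
next
  case False
  have "has_bochner_integral gaussian_space (\<lambda>\<omega>. (\<omega> i + \<omega> j) ^ 4) 12"
    using gaussian_combination_moments(3)[of "{i, j}" "\<lambda>_. 1"] False by (simp add: power4_eq_xxxx)
  moreover have "has_bochner_integral gaussian_space (\<lambda>\<omega>. (\<omega> i - \<omega> j) ^ 4) 12"
    using gaussian_combination_moments(3)[of "{i, j}" "\<lambda>k. if k = j then -1 else 1"] False by (simp add: power4_eq_xxxx)
  moreover have "has_bochner_integral gaussian_space (\<lambda>\<omega>. (\<omega> k) ^ 4) 3" for k
    using gaussian_combination_moments(3)[of "{k}" "\<lambda>_. 1"] by simp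
  ultimately have "has_bochner_integral gaussian_space
     (\<lambda>\<omega>. ((\<omega> i + \<omega> j) ^ 4 + (\<omega> i - \<omega> j) ^ 4 - 2 * (\<omega> i) ^ 4 - 2 * (\<omega> j) ^ 4) / 12) ((12 + 12 - 2 * 3 - 2 * 3) / 12)"
    by (intro has_bochner_integral_divide_zero has_bochner_integral_diff has_bochner_integral_add has_bochner_integral_mult_right) auto
  moreover have "((\<omega> i + \<omega> j) ^ 4 + (\<omega> i - \<omega> j) ^ 4 - 2 * (\<omega> i) ^ 4 - 2 * (\<omega> j) ^ 4) / 12 = (\<omega> i)\<^sup>2 * (\<omega> j)\<^sup>2" for \<omega> :: "nat \<times> bool \<Rightarrow> real"
    by (simp add: power4_eq_xxxx power2_eq_square algebra_simps)
  ultimately show ?thesis using False by simp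
qed

abbreviation gaussian_norm :: "nat \<Rightarrow> (nat \<times> bool \<Rightarrow> real) \<Rightarrow> real" where
  "gaussian_norm d \<omega> \<equiv> l2norm d (\<lambda>l. complex_gaussian l \<omega>)"

lemma gaussian_norm_square: "(gaussian_norm d \<omega>)\<^sup>2 = (\<Sum>i\<in>{..<d} \<times> UNIV. (\<omega> i)\<^sup>2) / 2"
proof -
  have "(cmod (complex_gaussian l \<omega>))\<^sup>2 = (\<Sum>b\<in>UNIV. (\<omega> (l, b))\<^sup>2) / 2" for l
    by (simp add: complex_gaussian_def norm_divide power_divide cmod_power2 UNIV_bool)
  then have "(gaussian_norm d \<omega>)\<^sup>2 = (\<Sum>l<d. \<Sum>b\<in>UNIV. (\<omega> (l, b))\<^sup>2) / 2"
    by (simp only: l2norm_square sum_divide_distrib)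
  then show ?thesis by (simp add: sum.cartesian_product)
qed

lemma gaussian_norm_moments:
  shows "has_bochner_integral gaussian_space (\<lambda>\<omega>. (gaussian_norm d \<omega>)\<^sup>2) (real d)"
    and "has_bochner_integral gaussian_space (\<lambda>\<omega>. (gaussian_norm d \<omega>) ^ 4) ((real d)\<^sup>2 + real d)"
proof -
  let ?I = "{..<d} \<times> (UNIV :: bool set)"
  have "has_bochner_integral gaussian_space (\<lambda>\<omega>. (\<omega> i)\<^sup>2) 1" for i
    using gaussian_combination_moments(2)[of "{i}" "\<lambda>_. 1"] by simp
  then have "has_bochner_integral gaussian_space (\<lambda>\<omega>. (\<Sum>i\<in>?I. (\<omega> i)\<^sup>2) / 2) ((\<Sum>i\<in>?I. 1) / 2)"
    by (intro has_bochner_integral_divide_zero has_bochner_integral_sum) auto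
  then show "has_bochner_integral gaussian_space (\<lambda>\<omega>. (gaussian_norm d \<omega>)\<^sup>2) (real d)"
    by (simp add: gaussian_norm_square)
  have "has_bochner_integral gaussian_space (\<lambda>\<omega>. (\<Sum>i\<in>?I. \<Sum>j\<in>?I. (\<omega> i)\<^sup>2 * (\<omega> j)\<^sup>2) / 4)
      ((\<Sum>i\<in>?I. \<Sum>j\<in>?I. if i = j then 3 else 1) / 4)"
    by (intro has_bochner_integral_divide_zero has_bochner_integral_sum gaussian_square_product)
  moreover have "(\<Sum>i\<in>?I. \<Sum>j\<in>?I. (\<omega> i)\<^sup>2 * (\<omega> j)\<^sup>2) / 4 = (gaussian_norm d \<omega>) ^ 4" for \<omega>
  proof -
    have "(gaussian_norm d \<omega>) ^ 4 = ((gaussian_norm d \<omega>)\<^sup>2)\<^sup>2" by simp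
    also have "\<dots> = (\<Sum>i\<in>?I. (\<omega> i)\<^sup>2) * (\<Sum>i\<in>?I. (\<omega> i)\<^sup>2) / 4"
      unfolding gaussian_norm_square by (simp add: power2_eq_square)
    finally show ?thesis by (simp add: sum_product)
  qed
  moreover have "(\<Sum>i\<in>?I. \<Sum>j\<in>?I. if i = j then 3 else 1) / 4 = (real d)\<^sup>2 + real d"
  proof -
    have "(\<Sum>j\<in>?I. if i = j then 3 else 1) = 2 * real d + 2" if "i \<in> ?I" for i
    proof -
      have "(\<Sum>j\<in>?I. if i = j then 3 else 1) = (\<Sum>j\<in>?I. 1 + (if i = j then 2 else 0 :: real))"
        by (intro sum.cong) auto
      also have "\<dots> = 2 * real d + 2"
        using that by (simp only: sum.distrib) simp
      finally show ?thesis .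
    qed
    then have "(\<Sum>i\<in>?I. \<Sum>j\<in>?I. if i = j then 3 else 1) = (\<Sum>i\<in>?I. 2 * real d + 2)"
      by (intro sum.cong) auto
    also have "\<dots> = 4 * ((real d)\<^sup>2 + real d)" by (simp add: algebra_simps power2_eq_square)
    finally show ?thesis by simp
  qed
  ultimately show "has_bochner_integral gaussian_space (\<lambda>\<omega>. (gaussian_norm d \<omega>) ^ 4) ((real d)\<^sup>2 + real d)"
    by simp
qed

lemma integrable_complex_gaussian [simp]: "integrable gaussian_space (complex_gaussian l)"
proof -
  have "gaussian_form (Suc l) (\<lambda>m. if m = l then 1 else 0) = complex_gaussian l"
    by (auto simp: gaussian_form_def fun_eq_iff if_distrib[of "\<lambda>x. x * _"] cong: if_cong)
  then show ?thesis by (metis integrable_gaussian_form)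
qed

lemma measurable_gaussian_norm [measurable]: "gaussian_norm d \<in> borel_measurable gaussian_space"
  unfolding L2_set_def by measurable

lemma integrable_gaussian_norm [simp]: "integrable gaussian_space (gaussian_norm d)"
proof (rule Bochner_Integration.integrable_bound)
  show "integrable gaussian_space (\<lambda>\<omega>. \<Sum>l<d. cmod (complex_gaussian l \<omega>))"
    by (intro Bochner_Integration.integrable_sum integrable_norm integrable_complex_gaussian)
  show "AE \<omega> in gaussian_space. norm (gaussian_norm d \<omega>) \<le> norm (\<Sum>l<d. cmod (complex_gaussian l \<omega>))"
    by (rule AE_I2) (auto intro!: order_trans[OF L2_set_le_sum] simp: sum_nonneg)
qed measurable

text \<open>
  In high dimension the length of a Gaussian vector is nearly constant. The polynomial
  inequality \<open>t \<ge> (3 t\<^sup>2 - t\<^sup>4) / 2\<close> for \<open>t \<ge> 0\<close>, with equality to first order at \<open>t = 1\<close>, turns the second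
  and fourth moments into a lower bound of the first.
\<close>

lemma expectation_gaussian_norm_ge:
  assumes "d \<ge> 1"
  shows "sqrt d * (1 - 1 / (2 * real d)) \<le> (\<integral>\<omega>. gaussian_norm d \<omega> \<partial>gaussian_space)"
proof -
  define r where "r = sqrt (real d)"
  have r: "r > 0" "r\<^sup>2 = real d" using assms by (auto simp: r_def)
  have "r * ((3 * ((gaussian_norm d \<omega>)\<^sup>2 / r\<^sup>2) - (gaussian_norm d \<omega>) ^ 4 / r ^ 4) / 2) \<le> gaussian_norm d \<omega>" for \<omega>
  proof -
    define t where "t = gaussian_norm d \<omega> / r"
    have t: "t \<ge> 0" "gaussian_norm d \<omega> = r * t" using r by (auto simp: t_def)
    have "0 \<le> t * ((t - 1)\<^sup>2 * (t + 2))" using t by simp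
    also have "\<dots> = t ^ 4 - 3 * t\<^sup>2 + 2 * t"
      by (simp add: power2_eq_square power4_eq_xxxx algebra_simps)
    finally have "(3 * t\<^sup>2 - t ^ 4) / 2 \<le> t" by simp
    then have "r * ((3 * t\<^sup>2 - t ^ 4) / 2) \<le> r * t" using r by (intro mult_left_mono) auto
    then show ?thesis using r assms by (simp only: t(2) power_mult_distrib) simp
  qed
  moreover have "has_bochner_integral gaussian_space
     (\<lambda>\<omega>. r * ((3 * ((gaussian_norm d \<omega>)\<^sup>2 / r\<^sup>2) - (gaussian_norm d \<omega>) ^ 4 / r ^ 4) / 2))
     (r * ((3 * (real d / r\<^sup>2) - ((real d)\<^sup>2 + real d) / r ^ 4) / 2))"
    by (intro has_bochner_integral_divide_zero has_bochner_integral_diff has_bochner_integral_mult_right gaussian_norm_moments)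
  ultimately have "r * ((3 * (real d / r\<^sup>2) - ((real d)\<^sup>2 + real d) / r ^ 4) / 2) \<le> (\<integral>\<omega>. gaussian_norm d \<omega> \<partial>gaussian_space)"
    by (intro has_bochner_integral_mono[OF _ has_bochner_integral_integrable[OF integrable_gaussian_norm]])
  moreover have "r ^ 4 = (real d)\<^sup>2" unfolding r(2)[symmetric] by simp
  moreover have "(3 * (real d / real d) - ((real d)\<^sup>2 + real d) / (real d)\<^sup>2) / 2 = 1 - 1 / (2 * real d)"
    using assms by (simp add: field_simps power2_eq_square)
  ultimately show ?thesis using r by (simp only: r_def[symmetric])
qed

section \<open>Finite approximation of the Gaussian vector\<close>

lemma simple_function_restrict:
  assumes "finite I" and f: "\<And>i. i \<in> I \<Longrightarrow> simple_function M (f i)"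
  shows "simple_function M (\<lambda>\<omega>. \<lambda>i\<in>I. f i \<omega>)"
  unfolding simple_function_def
proof (intro conjI ballI)
  have "(\<lambda>\<omega>. \<lambda>i\<in>I. f i \<omega>) ` space M \<subseteq> PiE I (\<lambda>i. f i ` space M)" by auto
  then show "finite ((\<lambda>\<omega>. \<lambda>i\<in>I. f i \<omega>) ` space M)"
    by (rule finite_subset) (use assms in \<open>auto intro!: finite_PiE simp: simple_function_def\<close>)
  fix y assume "y \<in> (\<lambda>\<omega>. \<lambda>i\<in>I. f i \<omega>) ` space M"
  then have "y \<in> extensional I" by auto
  then have "(\<lambda>i\<in>I. f i \<omega>) = y \<longleftrightarrow> (\<forall>i\<in>I. f i \<omega> = y i)" for \<omega>
    by (auto intro!: extensionalityI[of _ I])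
  then have "(\<lambda>\<omega>. \<lambda>i\<in>I. f i \<omega>) -` {y} \<inter> space M = {\<omega>\<in>space M. \<forall>i\<in>I. \<omega> \<in> f i -` {y i} \<inter> space M}"
    by auto
  also have "\<dots> \<in> sets M"
    using assms by (intro sets.sets_Collect_finite_All) (auto simp: simple_functionD)
  finally show "(\<lambda>\<omega>. \<lambda>i\<in>I. f i \<omega>) -` {y} \<inter> space M \<in> sets M" .
qed

lemma (in prob_space) expectation_simple_function:
  fixes \<phi> :: "'b \<Rightarrow> 'c :: {banach, second_countable_topology}"
  assumes F: "simple_function M F"
  shows "has_bochner_integral M (\<lambda>\<omega>. \<phi> (F \<omega>)) (\<Sum>y\<in>F ` space M. prob (F -` {y} \<inter> space M) *\<^sub>R \<phi> y)"
proof -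
  have fin: "finite (F ` space M)" using F by (simp add: simple_function_def)
  have "has_bochner_integral M (\<lambda>\<omega>. \<Sum>y\<in>F ` space M. indicator (F -` {y} \<inter> space M) \<omega> *\<^sub>R \<phi> y)
     (\<Sum>y\<in>F ` space M. prob (F -` {y} \<inter> space M) *\<^sub>R \<phi> y)"
    using F by (intro has_bochner_integral_sum has_bochner_integral_scaleR_left has_bochner_integral_real_indicator)
      (auto simp: simple_functionD less_top[symmetric])
  moreover have "(\<Sum>y\<in>F ` space M. indicator (F -` {y} \<inter> space M) \<omega> *\<^sub>R \<phi> y) = \<phi> (F \<omega>)" if "\<omega> \<in> space M" for \<omega>
  proof -
    have "(\<Sum>y\<in>F ` space M. indicator (F -` {y} \<inter> space M) \<omega> *\<^sub>R \<phi> y) = (\<Sum>y\<in>F ` space M. if y = F \<omega> then \<phi> y else 0)"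
      using that by (intro sum.cong) (auto simp: indicator_def)
    then show ?thesis using that fin by simp
  qed
  ultimately show ?thesis
    by (subst has_bochner_integral_cong[OF refl _ refl]) auto
qed

text \<open>
  Finitely many weighted points behave like a Gaussian vector up to \<open>\<epsilon>\<close>, uniformly in the direction
  \<open>v\<close>. They are the values of a simple function that approximates the vector in mean; the
  mean error controls all directions at once because \<open>|\<langle>e, v\<rangle>| \<le> |e| |v|\<close>.
\<close>

lemma gaussian_discretization:
  assumes "d \<ge> 1" and "\<epsilon> > 0"
  obtains Y :: "(nat \<Rightarrow> complex) set" and p :: "(nat \<Rightarrow> complex) \<Rightarrow> real"
  where "finite Y" and "\<And>y. p y \<ge> 0" and "sum p Y = 1"
    and "\<And>v. (\<Sum>y\<in>Y. p y * cmod (\<Sum>l<d. v l * y l)) \<le> (sqrt pi / 2 + \<epsilon>) * l2norm d v"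
    and "sqrt d * (1 - 1 / (2 * real d)) - \<epsilon> \<le> (\<Sum>y\<in>Y. p y * l2norm d y)"
proof -
  have "\<exists>F. (\<forall>k. simple_function gaussian_space (F k)) \<and>
      (\<forall>\<omega>\<in>space gaussian_space. (\<lambda>k. F k \<omega>) \<longlonglongrightarrow> complex_gaussian l \<omega>) \<and>
      (\<forall>k. \<forall>\<omega>\<in>space gaussian_space. dist (F k \<omega>) 0 \<le> 2 * dist (complex_gaussian l \<omega>) 0)" for l
    by (rule borel_measurable_implies_sequence_metric) measurable
  then obtain F where F: "\<And>l k. simple_function gaussian_space (F l k)"
    "\<And>l \<omega>. \<omega> \<in> space gaussian_space \<Longrightarrow> (\<lambda>k. F l k \<omega>) \<longlonglongrightarrow> complex_gaussian l \<omega>"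
    "\<And>l k \<omega>. \<omega> \<in> space gaussian_space \<Longrightarrow> cmod (F l k \<omega>) \<le> 2 * cmod (complex_gaussian l \<omega>)"
    unfolding dist_0_norm dist_norm diff_zero by metis
  have Fm [measurable]: "F l k \<in> borel_measurable gaussian_space" for l k
    by (intro borel_measurable_simple_function F)
  define err where "err k \<omega> = (\<Sum>l<d. cmod (F l k \<omega> - complex_gaussian l \<omega>))" for k \<omega>
  have err_m [measurable]: "err k \<in> borel_measurable gaussian_space" for k
    unfolding err_def by measurable
  have bound: "integrable gaussian_space (\<lambda>\<omega>. \<Sum>l<d. 3 * cmod (complex_gaussian l \<omega>))"
    by (intro Bochner_Integration.integrable_sum integrable_mult_right integrable_norm integrable_complex_gaussian)
  have err_le: "\<bar>err k \<omega>\<bar> \<le> (\<Sum>l<d. 3 * cmod (complex_gaussian l \<omega>))" if "\<omega> \<in> space gaussian_space" for k \<omega>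
  proof -
    have "cmod (F l k \<omega> - complex_gaussian l \<omega>) \<le> 3 * cmod (complex_gaussian l \<omega>)" for l
      using norm_triangle_ineq4[of "F l k \<omega>" "complex_gaussian l \<omega>"] F(3)[OF that, of l k] by linarith
    then show ?thesis unfolding err_def by (simp add: sum_nonneg sum_mono)
  qed
  have err_int: "integrable gaussian_space (err k)" for k
    by (rule Bochner_Integration.integrable_bound[OF bound]) (auto intro!: AE_I2 order_trans[OF err_le] abs_ge_self)
  have "(\<lambda>k. \<integral>\<omega>. err k \<omega> \<partial>gaussian_space) \<longlonglongrightarrow> (\<integral>\<omega>. 0 \<partial>gaussian_space)"
  proof (rule integral_dominated_convergence[OF _ _ bound])
    show "AE \<omega> in gaussian_space. (\<lambda>k. err k \<omega>) \<longlonglongrightarrow> 0"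
    proof (rule AE_I2)
      fix \<omega> assume "\<omega> \<in> space gaussian_space"
      then have "(\<lambda>k. err k \<omega>) \<longlonglongrightarrow> (\<Sum>l<d. cmod (complex_gaussian l \<omega> - complex_gaussian l \<omega>))"
        unfolding err_def by (intro tendsto_intros F(2))
      then show "(\<lambda>k. err k \<omega>) \<longlonglongrightarrow> 0" by simp
    qed
  qed (auto intro!: AE_I2 err_le)
  then have "\<forall>\<^sub>F k in sequentially. (\<integral>\<omega>. err k \<omega> \<partial>gaussian_space) < \<epsilon>"
    using assms(2) by (intro order_tendstoD) auto
  then obtain k where k: "(\<integral>\<omega>. err k \<omega> \<partial>gaussian_space) < \<epsilon>"
    by (auto simp: eventually_sequentially)
  define G where "G \<omega> = (\<lambda>l\<in>{..<d}. F l k \<omega>)" for \<omega>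
  have G: "simple_function gaussian_space G"
    unfolding G_def by (intro simple_function_restrict F) simp
  define Y where "Y = G ` space gaussian_space"
  define p where "p y = gauss.prob (G -` {y} \<inter> space gaussian_space)" for y
  have law: "has_bochner_integral gaussian_space (\<lambda>\<omega>. \<phi> (G \<omega>)) (\<Sum>y\<in>Y. p y * \<phi> y)" for \<phi> :: "(nat \<Rightarrow> complex) \<Rightarrow> real"
    using gauss.expectation_simple_function[OF G, of \<phi>] by (simp add: Y_def p_def)
  show ?thesis
  proof
    show "finite Y" using G by (simp add: Y_def simple_function_def)
    show "p y \<ge> 0" for y by (simp add: p_def)
    show "sum p Y = 1"
      using law[of "\<lambda>_. 1"] gauss.prob_space by (simp add: has_bochner_integral_iff)
    show "(\<Sum>y\<in>Y. p y * cmod (\<Sum>l<d. v l * y l)) \<le> (sqrt pi / 2 + \<epsilon>) * l2norm d v" for v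
    proof -
      have pt: "cmod (\<Sum>l<d. v l * G \<omega> l) \<le> cmod (gaussian_form d v \<omega>) + l2norm d v * err k \<omega>" for \<omega>
      proof -
        have "(\<Sum>l<d. v l * G \<omega> l) = gaussian_form d v \<omega> + (\<Sum>l<d. v l * (F l k \<omega> - complex_gaussian l \<omega>))"
          by (simp add: G_def gaussian_form_def sum.distrib[symmetric] algebra_simps)
        moreover have "cmod (\<Sum>l<d. v l * (F l k \<omega> - complex_gaussian l \<omega>)) \<le> (\<Sum>l<d. l2norm d v * cmod (F l k \<omega> - complex_gaussian l \<omega>))"
          by (intro sum_norm_le) (auto simp: norm_mult intro!: mult_right_mono member_le_L2_set)
        ultimately show ?thesis
          using norm_triangle_ineq[of "gaussian_form d v \<omega>" "\<Sum>l<d. v l * (F l k \<omega> - complex_gaussian l \<omega>)"]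
          by (simp add: err_def sum_distrib_left)
      qed
      have "(\<Sum>y\<in>Y. p y * cmod (\<Sum>l<d. v l * y l)) = (\<integral>\<omega>. cmod (\<Sum>l<d. v l * G \<omega> l) \<partial>gaussian_space)"
        using law[of "\<lambda>y. cmod (\<Sum>l<d. v l * y l)"] by (simp add: has_bochner_integral_iff)
      also have "\<dots> \<le> (\<integral>\<omega>. cmod (gaussian_form d v \<omega>) + l2norm d v * err k \<omega> \<partial>gaussian_space)"
        by (intro integral_mono pt integrable.intros[OF law] Bochner_Integration.integrable_add
            integrable.intros[OF gaussian_form_abs] integrable_mult_right err_int)
      also have "\<dots> = sqrt pi / 2 * l2norm d v + l2norm d v * (\<integral>\<omega>. err k \<omega> \<partial>gaussian_space)"
        using gaussian_form_abs[of d v] err_int[of k] by (simp add: has_bochner_integral_iff)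
      also have "\<dots> \<le> sqrt pi / 2 * l2norm d v + l2norm d v * \<epsilon>"
        using k by (intro add_left_mono mult_left_mono) auto
      finally show ?thesis by (simp add: algebra_simps)
    qed
    show "sqrt d * (1 - 1 / (2 * real d)) - \<epsilon> \<le> (\<Sum>y\<in>Y. p y * l2norm d y)"
    proof -
      have pt: "gaussian_norm d \<omega> - err k \<omega> \<le> l2norm d (G \<omega>)" for \<omega>
      proof -
        have "gaussian_norm d \<omega> \<le> L2_set (\<lambda>l. cmod (G \<omega> l) + cmod (F l k \<omega> - complex_gaussian l \<omega>)) {..<d}"
        proof (rule L2_set_mono)
          fix l assume "l \<in> {..<d}"
          then show "cmod (complex_gaussian l \<omega>) \<le> cmod (G \<omega> l) + cmod (F l k \<omega> - complex_gaussian l \<omega>)"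
            using norm_triangle_ineq4[of "F l k \<omega>" "F l k \<omega> - complex_gaussian l \<omega>"] by (simp add: G_def)
        qed simp
        also have "\<dots> \<le> l2norm d (G \<omega>) + L2_set (\<lambda>l. cmod (F l k \<omega> - complex_gaussian l \<omega>)) {..<d}"
          by (rule L2_set_triangle_ineq)
        also have "\<dots> \<le> l2norm d (G \<omega>) + err k \<omega>"
          unfolding err_def by (intro add_left_mono L2_set_le_sum) auto
        finally show ?thesis by simp
      qed
      have "sqrt d * (1 - 1 / (2 * real d)) - \<epsilon> \<le> (\<integral>\<omega>. gaussian_norm d \<omega> \<partial>gaussian_space) - (\<integral>\<omega>. err k \<omega> \<partial>gaussian_space)"
        using expectation_gaussian_norm_ge[OF assms(1)] k by simp
      also have "\<dots> = (\<integral>\<omega>. gaussian_norm d \<omega> - err k \<omega> \<partial>gaussian_space)"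
        by (subst Bochner_Integration.integral_diff) (auto simp: err_int)
      also have "\<dots> \<le> (\<integral>\<omega>. l2norm d (G \<omega>) \<partial>gaussian_space)"
        by (intro integral_mono pt integrable.intros[OF law] Bochner_Integration.integrable_diff
            integrable_gaussian_norm err_int)
      also have "\<dots> = (\<Sum>y\<in>Y. p y * l2norm d y)"
        using law[of "l2norm d"] by (simp add: has_bochner_integral_iff)
      finally show ?thesis .
    qed
  qed
qed

section \<open>Positive semidefinite matrices as Gram matrices\<close>

unbundle no vec_syntax

definition hermitian_form :: "nat \<Rightarrow> (nat \<Rightarrow> nat \<Rightarrow> complex) \<Rightarrow> (nat \<Rightarrow> complex) \<Rightarrow> complex" where
  "hermitian_form n a x = (\<Sum>i<n. \<Sum>j<n. cnj (x i) * a i j * x j)"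

lemma positive_semidef_iff:
  "positive_semidef n A \<longleftrightarrow>
     A \<in> carrier_mat n n \<and> (\<forall>x. 0 \<le> hermitian_form n (\<lambda>i j. A $$ (i, j)) x)"
proof -
  have eq: "(A *\<^sub>v v) \<bullet>c v = hermitian_form n (\<lambda>i j. A $$ (i, j)) (\<lambda>i. v $ i)"
    if "A \<in> carrier_mat n n" "v \<in> carrier_vec n" for v
    using that by (simp add: hermitian_form_def scalar_prod_def sum_distrib_left sum_distrib_right
        lessThan_atLeast0 mult_ac)
  show ?thesis
  proof (cases "A \<in> carrier_mat n n")
    case True
    have *: "hermitian_form n (\<lambda>i j. A $$ (i, j)) (\<lambda>i. vec n x $ i) = hermitian_form n (\<lambda>i j. A $$ (i, j)) x" for x
      unfolding hermitian_form_def by (intro sum.cong) auto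
    then have "0 \<le> hermitian_form n (\<lambda>i j. A $$ (i, j)) x"
      if "\<forall>v\<in>carrier_vec n. 0 \<le> (A *\<^sub>v v) \<bullet>c v" for x
      using that[rule_format, of "vec n x"] eq[OF True, of "vec n x"] * by simp
    then show ?thesis using True eq unfolding positive_semidef_def by auto
  qed (simp add: positive_semidef_def)
qed

lemma hermitian_form_two_point:
  assumes "i < n" "j < n" "i \<noteq> j"
  shows "hermitian_form n a (\<lambda>k. if k = i then s else if k = j then t else 0) =
    cnj s * a i i * s + cnj s * a i j * t + cnj t * a j i * s + cnj t * a j j * t"
proof -
  have pair: "(\<Sum>k<n. if k = i then f k else if k = j then g k else 0) = f i + g j" for f g :: "nat \<Rightarrow> complex"
  proof -
    have "(\<Sum>k<n. if k = i then f k else if k = j then g k else 0) = (\<Sum>k<n. (if k = i then f k else 0) + (if k = j then g k else 0))"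
      using assms(3) by (intro sum.cong) auto
    then show ?thesis using assms by (simp add: sum.distrib)
  qed
  have *: "cnj (if k = i then s else if k = j then t else 0) * a k l * (if l = i then s else if l = j then t else 0)
    = (if k = i then (if l = i then cnj s * a i i * s else if l = j then cnj s * a i j * t else 0)
       else if k = j then (if l = i then cnj t * a j i * s else if l = j then cnj t * a j j * t else 0) else 0)" for k l
    using assms(3) by auto
  have "(\<Sum>l<n. if k = i then (if l = i then cnj s * a i i * s else if l = j then cnj s * a i j * t else 0)
       else if k = j then (if l = i then cnj t * a j i * s else if l = j then cnj t * a j j * t else 0) else 0)
     = (if k = i then cnj s * a i i * s + cnj s * a i j * t else if k = j then cnj t * a j i * s + cnj t * a j j * t else 0)" for k
    using pair[of "\<lambda>_. cnj s * a i i * s" "\<lambda>_. cnj s * a i j * t"] pair[of "\<lambda>_. cnj t * a j i * s" "\<lambda>_. cnj t * a j j * t"] by simp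
  then show ?thesis
    unfolding hermitian_form_def * by (simp add: pair)
qed

lemma hermitian_form_unit_vector:
  assumes "i < n"
  shows "hermitian_form n a (\<lambda>k. if k = i then 1 else 0) = a i i"
proof -
  have "cnj (if k = i then 1 else 0) * a k l * (if l = i then 1 else 0) = (if k = i then if l = i then a i i else 0 else 0)" for k l
    by auto
  then have "hermitian_form n a (\<lambda>k. if k = i then 1 else 0) = (\<Sum>k<n. \<Sum>l<n. if k = i then if l = i then a i i else 0 else 0)"
    unfolding hermitian_form_def by (simp only: )
  also have "\<dots> = (\<Sum>k<n. if k = i then a i i else 0)"
    using assms by (intro sum.cong) auto
  finally show ?thesis using assms by simp
qed

context
  fixes n :: nat and a :: "nat \<Rightarrow> nat \<Rightarrow> complex"
  assumes pos: "\<And>x. 0 \<le> hermitian_form n a x"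
begin

lemma pos_form_diagonal: "i < n \<Longrightarrow> 0 \<le> a i i"
  using pos[of "\<lambda>k. if k = i then 1 else 0"] by (simp only: hermitian_form_unit_vector)

lemma pos_form_hermitian:
  assumes "i < n" "j < n"
  shows "a j i = cnj (a i j)"
proof (cases "i = j")
  case True
  then show ?thesis using pos_form_diagonal[OF assms(1)] by (simp add: less_eq_complex_def complex_eq_iff)
next
  case False
  have "0 \<le> cnj s * a i i * s + cnj s * a i j * t + cnj t * a j i * s + cnj t * a j j * t" for s t
    using pos[of "\<lambda>k. if k = i then s else if k = j then t else 0"]
    by (simp only: hermitian_form_two_point[OF assms False])
  from this[of 1 1] this[of 1 \<i>] show ?thesis
    using pos_form_diagonal[OF assms(1)] pos_form_diagonal[OF assms(2)]
    by (simp add: less_eq_complex_def complex_eq_iff)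
qed

text \<open>
  Otherwise the form would become negative at a vector with entry \<open>1\<close> at \<open>i\<close> and a large multiple of
  \<open>- cnj (a i j)\<close> at \<open>j\<close>.
\<close>

lemma pos_form_null_column:
  assumes "i < n" "j < n" "a j j = 0"
  shows "a i j = 0"
proof (cases "i = j")
  case False
  define r where "r = Re (a i i)"
  define q where "q = (cmod (a i j))\<^sup>2"
  have "0 \<le> r - 2 * N * q" for N :: real
  proof -
    have "0 \<le> cnj 1 * a i i * 1 + cnj 1 * a i j * (- of_real N * cnj (a i j))
        + cnj (- of_real N * cnj (a i j)) * a j i * 1 + cnj (- of_real N * cnj (a i j)) * a j j * (- of_real N * cnj (a i j))"
      using pos[of "\<lambda>k. if k = i then 1 else if k = j then - of_real N * cnj (a i j) else 0"]
      by (simp only: hermitian_form_two_point[OF assms(1,2) False])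
    then show ?thesis
      unfolding pos_form_hermitian[OF assms(1,2)] assms(3) r_def q_def cmod_power2
      by (simp add: less_eq_complex_def power2_eq_square algebra_simps)
  qed
  from this[of "(r + 1) / (2 * q)"] have "q = 0" by (cases "q = 0") auto
  then show ?thesis by (simp add: q_def)
qed (use assms in auto)

end

text \<open>
  One step of the Cholesky decomposition: the Schur complement \<open>b\<close> of the last diagonal entry is
  again positive, since its form is the one of \<open>a\<close> with the last coordinate chosen to minimize it.
  If the last diagonal entry is \<open>0\<close>, then so are its row and column, and division by zero makes the
  same formulas correct.
\<close>

lemma gram_decomposition:
  assumes "\<And>x. 0 \<le> hermitian_form n a x"
  shows "\<exists>V. \<forall>i<n. \<forall>j<n. a i j = (\<Sum>l<n. V i l * cnj (V j l))"
  using assms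
proof (induction n arbitrary: a)
  case (Suc n)
  note herm = pos_form_hermitian[OF Suc.prems] and null = pos_form_null_column[OF Suc.prems]
  define r where "r = Re (a n n)"
  have r: "a n n = of_real r" "0 \<le> r"
    using pos_form_diagonal[OF Suc.prems, of n] by (auto simp: r_def less_eq_complex_def complex_eq_iff)
  define b where "b i j = a i j - a i n * a n j / of_real r" for i j
  have "0 \<le> hermitian_form n b x" for x
  proof -
    define w where "w = (\<Sum>j<n. a n j * x j)"
    \<comment> \<open>The last coordinate that minimizes the form; it is \<open>0\<close> if \<open>r = 0\<close>, where \<open>b\<close> agrees with \<open>a\<close>.\<close>
    define t where "t = - w / of_real r"
    have w': "(\<Sum>i<n. cnj (x i) * a i n) = cnj w"
      by (simp add: w_def herm[of n] mult.commute)
    have "0 \<le> hermitian_form (Suc n) a (x(n := t))" by (rule Suc.prems)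
    also have "hermitian_form (Suc n) a (x(n := t)) =
        hermitian_form n a x + (\<Sum>i<n. cnj (x i) * a i n) * t + cnj t * w + cnj t * a n n * t"
      by (simp add: hermitian_form_def sum.distrib w_def sum_distrib_left sum_distrib_right mult.assoc)
    also have "\<dots> = hermitian_form n a x - cnj w * w / of_real r"
      unfolding w' r(1) by (cases "r = 0") (simp_all add: t_def field_simps)
    also have "\<dots> = hermitian_form n b x"
    proof -
      have "hermitian_form n b x = hermitian_form n a x - (\<Sum>i<n. \<Sum>j<n. (cnj (x i) * a i n) * (a n j * x j)) / of_real r"
        by (simp add: hermitian_form_def b_def algebra_simps sum_subtractf sum_divide_distrib)
      then show ?thesis by (simp add: sum_product[symmetric] w' w_def[symmetric])
    qed
    finally show ?thesis .
  qed
  from Suc.IH[OF this] obtain V where V: "\<And>i j. i < n \<Longrightarrow> j < n \<Longrightarrow> b i j = (\<Sum>l<n. V i l * cnj (V j l))"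
    by blast
  define W where "W i l = (if l = n then a i n / of_real (sqrt r) else if i = n then 0 else V i l)" for i l
  have "a i j = (\<Sum>l<Suc n. W i l * cnj (W j l))" if ij: "i < Suc n" "j < Suc n" for i j
  proof -
    have sr: "of_real (sqrt r) * of_real (sqrt r) = (of_real r :: complex)"
      using r(2) by (simp add: of_real_mult[symmetric] del: of_real_mult)
    have last: "W i n * cnj (W j n) = a i n * a n j / of_real r"
      using herm[of j n] ij sr by (simp add: W_def)
    have "(\<Sum>l<n. W i l * cnj (W j l)) = a i j - a i n * a n j / of_real r"
    proof (cases "i < n \<and> j < n")
      case True
      then have "(\<Sum>l<n. W i l * cnj (W j l)) = b i j"
        by (simp add: V W_def)
      then show ?thesis by (simp add: b_def)
    next
      case False
      then have "(\<Sum>l<n. W i l * cnj (W j l)) = 0" using ij by (auto simp: W_def intro!: sum.neutral)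
      moreover have "a i j = a i n * a n j / of_real r"
      proof (cases "r = 0")
        case True
        then have "a k n = 0" if "k < Suc n" for k using null[of k n] r that by simp
        moreover from this have "a n k = 0" if "k < Suc n" for k using herm[of k n] that by simp
        ultimately show ?thesis using False ij by (auto simp: less_Suc_eq)
      next
        case r0: False
        then show ?thesis using False ij r by (auto simp: less_Suc_eq)
      qed
      ultimately show ?thesis by simp
    qed
    then show ?thesis using last by simp
  qed
  then show ?case by blast
qed simp

section \<open>The closed convex hull of the unimodular rank one matrices\<close>

lemma closedin_mat_topology_sequentially:
  assumes T: "closedin (mat_topology n) T" and X: "\<And>m. X m \<in> T" and R: "R \<in> carrier_mat n n"
    and lim: "\<And>i j. i < n \<Longrightarrow> j < n \<Longrightarrow> (\<lambda>m. X m $$ (i, j)) \<longlonglongrightarrow> R $$ (i, j)"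
  shows "R \<in> T"
proof (rule limitin_closedin[OF _ T])
  let ?f = "\<lambda>A :: complex mat. \<lambda>ij \<in> {..<n} \<times> {..<n}. A $$ ij"
  let ?P = "product_topology (\<lambda>_. euclidean) ({..<n} \<times> {..<n}) :: (nat \<times> nat \<Rightarrow> complex) topology"
  have XC: "X m \<in> carrier_mat n n" for m
    using closedin_subset[OF T] X[of m] by (auto simp: mat_topology_def topspace_pullback_topology)
  have lf: "limitin ?P (\<lambda>m. ?f (X m)) (?f R) sequentially"
    using lim by (auto simp: limitin_componentwise PiE_iff)
  show "limitin (mat_topology n) X R sequentially"
    unfolding limitin_def
  proof (intro conjI allI impI)
    show "R \<in> topspace (mat_topology n)"
      using R by (simp add: mat_topology_def topspace_pullback_topology PiE_iff)
    fix U assume "openin (mat_topology n) U \<and> R \<in> U"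
    then obtain W where W: "openin ?P W" "U = ?f -` W \<inter> carrier_mat n n" "?f R \<in> W"
      by (auto simp: mat_topology_def openin_pullback_topology)
    then have "\<forall>\<^sub>F m in sequentially. ?f (X m) \<in> W" using lf by (simp add: limitin_def)
    then show "\<forall>\<^sub>F m in sequentially. X m \<in> U"
      by eventually_elim (use W(2) XC in auto)
  qed
qed (use X in auto)

lemma continuous_map_mat_entry:
  assumes "i < n" "j < n"
  shows "continuous_map (mat_topology n) euclidean (\<lambda>A. A $$ (i, j))"
proof -
  have "continuous_map (mat_topology n) euclidean ((\<lambda>h. h (i, j)) \<circ> (\<lambda>A. \<lambda>ij \<in> {..<n} \<times> {..<n}. A $$ ij))"
    unfolding mat_topology_def
    by (intro continuous_map_pullback continuous_map_product_projection) (use assms in auto)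
  then show ?thesis using assms by (simp add: comp_def)
qed

lemma mat_convex_combination:
  assumes "mat_convex T" "T \<subseteq> carrier_mat n n" "finite Y"
    and "\<And>y. y \<in> Y \<Longrightarrow> f y \<in> T" "\<And>y. y \<in> Y \<Longrightarrow> 0 \<le> p y" "sum p Y = 1"
  shows "mat n n (\<lambda>ij. \<Sum>y\<in>Y. complex_of_real (p y) * f y $$ ij) \<in> T"
proof -
  have conv: "complex_of_real u \<cdot>\<^sub>m A + complex_of_real v \<cdot>\<^sub>m B \<in> T"
    if "A \<in> T" "B \<in> T" "u \<ge> 0" "v \<ge> 0" "u + v = 1" for A B u v
    using assms(1) that by (simp add: mat_convex_def)
  show ?thesis
    using assms(3-6)
  proof (induction Y arbitrary: p rule: finite_induct)
    case (insert z Y)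
    have fz: "f z \<in> T" "f z \<in> carrier_mat n n" using insert.prems assms(2) by auto
    show ?case
    proof (cases "sum p Y = 0")
      case True
      then have "p y = 0" if "y \<in> Y" for y using insert that by (simp add: sum_nonneg_eq_0_iff)
      moreover have "p z = 1" using insert True by simp
      ultimately have "mat n n (\<lambda>ij. \<Sum>y\<in>insert z Y. complex_of_real (p y) * f y $$ ij) = f z"
        using insert fz by (intro eq_matI) auto
      then show ?thesis using fz by simp
    next
      case False
      define c where "c = sum p Y"
      have c: "c > 0" using False insert.prems by (simp add: c_def order_less_le sum_nonneg)
      let ?B = "mat n n (\<lambda>ij. \<Sum>y\<in>Y. complex_of_real (p y / c) * f y $$ ij)"
      have "?B \<in> T"
        using insert.prems c by (intro insert.IH) (auto simp: c_def sum_divide_distrib[symmetric])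
      moreover have "p z + c = 1" using insert by (simp add: c_def)
      ultimately have "complex_of_real (p z) \<cdot>\<^sub>m f z + complex_of_real c \<cdot>\<^sub>m ?B \<in> T"
        using insert.prems c by (intro conv fz) auto
      also have "complex_of_real (p z) \<cdot>\<^sub>m f z + complex_of_real c \<cdot>\<^sub>m ?B =
          mat n n (\<lambda>ij. \<Sum>y\<in>insert z Y. complex_of_real (p y) * f y $$ ij)"
        using fz c insert(1,2) by (intro eq_matI) (auto simp: sum_distrib_left)
      finally show ?thesis .
    qed
  qed simp
qed

lemma unimodular_outer_product_rank_one:
  assumes "n \<ge> 1" and s: "\<And>i. cmod (s i) = 1"
  defines "A \<equiv> mat n n (\<lambda>(i, j). s i * cnj (s j))"
  shows "positive_semidef n A \<and> vec_space.rank n A = 1 \<and> diag_part n A = 1\<^sub>m n"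
proof (intro conjI)
  interpret vec_space "TYPE(complex)" n .
  have A: "A \<in> carrier_mat n n" by (simp add: A_def)
  have "hermitian_form n (\<lambda>i j. A $$ (i, j)) x = complex_of_real ((cmod (\<Sum>i<n. cnj (s i) * x i))\<^sup>2)" for x
  proof -
    have "hermitian_form n (\<lambda>i j. A $$ (i, j)) x = (\<Sum>i<n. \<Sum>j<n. (cnj (x i) * s i) * (cnj (s j) * x j))"
      unfolding hermitian_form_def A_def by (intro sum.cong refl) (simp add: mult_ac)
    then show ?thesis
      unfolding complex_norm_square by (simp add: sum_product mult_ac)
  qed
  then show "positive_semidef n A"
    by (simp add: positive_semidef_iff A less_eq_complex_def)
  have "s i * cnj (s i) = 1" for i using s[of i] complex_norm_square[of "s i"] by simp
  then show "diag_part n A = 1\<^sub>m n"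
    by (intro eq_matI) (auto simp: diag_part_def mat_diag_def A_def)
  have "rank A \<le> 1"
    by (rule rank_le_1_product_entries[OF A, of s "\<lambda>j. cnj (s j)"]) (simp add: A_def)
  moreover have "rank A \<ge> card {col A 0}"
  proof (rule rank_ge_card_indpt[OF A])
    show "{col A 0} \<subseteq> set (cols A)" using assms(1) A by (auto simp: cols_def)
    have "col A 0 $ 0 \<noteq> 0" using assms(1) s[of 0] by (auto simp: A_def)
    show "lin_indpt {col A 0}"
    proof (rule finite_lin_indpt2)
      show "{col A 0} \<subseteq> carrier_vec n" using A assms(1) by auto
      fix c assume "lincomb c {col A 0} = 0\<^sub>v n"
      then have "lincomb c {col A 0} $ 0 = 0" using assms(1) by simp
      moreover have "lincomb c {col A 0} $ 0 = c (col A 0) * col A 0 $ 0"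
        using A assms(1) by (subst lincomb_index) auto
      ultimately show "\<forall>v\<in>{col A 0}. c v = 0"
        using \<open>col A 0 $ 0 \<noteq> 0\<close> by simp
    qed simp
  qed
  ultimately show "vec_space.rank n A = 1" by simp
qed

text \<open>
  If a minor of size two did not vanish, the two columns that it involves would be linearly independent.
\<close>

lemma rank_one_minor:
  assumes A: "A \<in> carrier_mat n n" and rank: "vec_space.rank n (A :: complex mat) = 1"
    and ij: "i < n" "j < n" "k < n" "l < n"
  shows "A $$ (i, j) * A $$ (k, l) = A $$ (i, l) * A $$ (k, j)"
proof (rule ccontr)
  interpret vec_space "TYPE(complex)" n .
  assume ne: "A $$ (i, j) * A $$ (k, l) \<noteq> A $$ (i, l) * A $$ (k, j)"
  let ?U = "{col A j, col A l}"
  have entry: "col A j $ i = A $$ (i, j)" "col A j $ k = A $$ (k, j)" "col A l $ i = A $$ (i, l)" "col A l $ k = A $$ (k, l)"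
    using A ij by auto
  then have cols_ne: "col A j \<noteq> col A l" using ne by (metis mult.commute)
  have "rank A \<ge> card ?U"
  proof (rule rank_ge_card_indpt[OF A])
    show "?U \<subseteq> set (cols A)" using ij A by (auto simp: cols_def)
    show "lin_indpt ?U"
    proof (rule finite_lin_indpt2)
      show U: "?U \<subseteq> carrier_vec n" using A ij by auto
      fix c assume "lincomb c ?U = 0\<^sub>v n"
      then have z: "lincomb c ?U $ m = 0" if "m < n" for m using that by simp
      have "lincomb c ?U $ m = c (col A j) * col A j $ m + c (col A l) * col A l $ m" if "m < n" for m
        using A ij that cols_ne by (subst lincomb_index) auto
      then have e: "c (col A j) * A $$ (i, j) + c (col A l) * A $$ (i, l) = 0"
        "c (col A j) * A $$ (k, j) + c (col A l) * A $$ (k, l) = 0"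
        using z[of i] z[of k] ij by (simp_all add: entry)
      let ?D = "A $$ (i, j) * A $$ (k, l) - A $$ (i, l) * A $$ (k, j)"
      have "c (col A j) * ?D = A $$ (k, l) * (c (col A j) * A $$ (i, j) + c (col A l) * A $$ (i, l))
          - A $$ (i, l) * (c (col A j) * A $$ (k, j) + c (col A l) * A $$ (k, l))"
        and "c (col A l) * ?D = A $$ (i, j) * (c (col A j) * A $$ (k, j) + c (col A l) * A $$ (k, l))
          - A $$ (k, j) * (c (col A j) * A $$ (i, j) + c (col A l) * A $$ (i, l))"
        by (simp_all only: algebra_simps)
      then have "c (col A j) * ?D = 0" "c (col A l) * ?D = 0" by (simp_all only: e mult_zero_right diff_zero)
      then show "\<forall>v\<in>?U. c v = 0" using ne by auto
    qed simp
  qed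
  then show False using rank cols_ne by simp
qed

text \<open>
  The first column serves as \<open>s\<close>: the minor with rows \<open>i\<close>, \<open>0\<close> and columns \<open>0\<close>, \<open>j\<close> vanishes, the
  diagonal is \<open>1\<close> and the matrix is Hermitian.
\<close>

lemma rank_one_unimodular:
  assumes "n \<ge> 1" "positive_semidef n A" "vec_space.rank n A = 1" "diag_part n A = 1\<^sub>m n"
  obtains s where "\<And>i. i < n \<Longrightarrow> cmod (s i) = 1"
    and "\<And>i j. i < n \<Longrightarrow> j < n \<Longrightarrow> A $$ (i, j) = s i * cnj (s j)"
proof
  have A: "A \<in> carrier_mat n n" using assms by (simp add: positive_semidef_def)
  have diag: "A $$ (i, i) = 1" if "i < n" for i
    using that arg_cong[OF assms(4), of "\<lambda>B. B $$ (i, i)"] by (simp add: diag_part_def mat_diag_def)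
  have herm: "A $$ (j, i) = cnj (A $$ (i, j))" if "i < n" "j < n" for i j
    by (rule pos_form_hermitian[of n "\<lambda>i j. A $$ (i, j)"]) (use assms(2) that in \<open>auto simp: positive_semidef_iff\<close>)
  note minor = rank_one_minor[OF A assms(3)]
  show gram: "A $$ (i, j) = A $$ (i, 0) * cnj (A $$ (j, 0))" if "i < n" "j < n" for i j
  proof -
    have "0 < n" using assms(1) by simp
    then have "A $$ (i, 0) * A $$ (0, j) = A $$ (i, j) * 1"
      using minor[of i 0 0 j] diag[of 0] that by (simp only:)
    then show ?thesis
      using herm[OF that(2) \<open>0 < n\<close>] by (simp only: mult_1_right)
  qed
  have "complex_of_real ((cmod (A $$ (i, 0)))\<^sup>2) = 1" if "i < n" for i
    unfolding complex_norm_square gram[OF that that, symmetric] by (rule diag[OF that])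
  then have "(cmod (A $$ (i, 0)))\<^sup>2 = 1" if "i < n" for i
    using that of_real_eq_1_iff by blast
  then have *: "cmod (A $$ (i, 0)) = 1 \<or> cmod (A $$ (i, 0)) = - 1" if "i < n" for i
    using that by (simp add: power2_eq_1_iff)
  show "cmod (A $$ (i, 0)) = 1" if "i < n" for i
    using *[OF that] norm_ge_zero[of "A $$ (i, 0)"] by linarith
qed

lemma unit_phase_unimodular: "cmod z = 1 \<Longrightarrow> unit_phase z = z"
  by (auto simp: unit_phase_def sgn_eq)

lemma tendsto_unit_phase:
  assumes "(f \<longlongrightarrow> l) F" "l \<noteq> 0"
  shows "((\<lambda>x. unit_phase (f x)) \<longlongrightarrow> unit_phase l) F"
proof -
  have "\<forall>\<^sub>F x in F. f x \<noteq> 0"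
    using assms by (rule tendsto_imp_eventually_ne)
  then have "\<forall>\<^sub>F x in F. sgn (f x) = unit_phase (f x)"
    by eventually_elim (simp add: unit_phase_def)
  moreover have "((\<lambda>x. sgn (f x)) \<longlongrightarrow> unit_phase l) F"
    using tendsto_sgn[OF assms] assms(2) by (simp add: unit_phase_def)
  ultimately show ?thesis by (rule Lim_transform_eventually[rotated])
qed

lemma (in prob_space) integrable_unimodular_product:
  assumes "f \<in> borel_measurable M" "g \<in> borel_measurable M"
    and "\<And>\<omega>. cmod (f \<omega>) = 1" "\<And>\<omega>. cmod (g \<omega>) = 1"
  shows "integrable M (\<lambda>\<omega>. f \<omega> * cnj (g \<omega>))"
  using borel_measurable_times[OF assms(1) measurable_compose[OF assms(2) measurable_cnj]]
  by (intro integrable_const_bound[of _ 1]) (auto simp: norm_mult assms)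

text \<open>
  The expectation is a limit of finite convex combinations: each \<open>s i\<close> is the pointwise limit of
  simple functions, whose phases are again simple and unimodular, and dominated convergence applies to
  the entries.
\<close>

lemma (in prob_space) expectation_unimodular_in_R_set:
  fixes s :: "nat \<Rightarrow> 'a \<Rightarrow> complex"
  assumes n: "n \<ge> 1" and s [measurable]: "\<And>i. s i \<in> borel_measurable M" and unim: "\<And>i \<omega>. cmod (s i \<omega>) = 1"
  shows "mat n n (\<lambda>(i, j). expectation (\<lambda>\<omega>. s i \<omega> * cnj (s j \<omega>))) \<in> R_set n"
  unfolding R_set_def closed_convex_hull_def hull_def
proof (intro InterI, clarify)
  fix T assume T: "closedin (mat_topology n) T" "mat_convex T"
    and gen: "{A. positive_semidef n A \<and> vec_space.rank n A = 1 \<and> diag_part n A = 1\<^sub>m n} \<subseteq> T"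
  have Tc: "T \<subseteq> carrier_mat n n"
    using closedin_subset[OF T(1)] by (auto simp: mat_topology_def topspace_pullback_topology)
  have "\<exists>F. (\<forall>k. simple_function M (F k)) \<and> (\<forall>\<omega>\<in>space M. (\<lambda>k. F k \<omega>) \<longlonglongrightarrow> s i \<omega>)" for i
    using borel_measurable_implies_sequence_metric[OF s, of i 0] by blast
  then obtain F where F: "\<And>i k. simple_function M (F i k)"
    "\<And>i \<omega>. \<omega> \<in> space M \<Longrightarrow> (\<lambda>k. F i k \<omega>) \<longlonglongrightarrow> s i \<omega>" by metis
  define S where "S k i \<omega> = unit_phase (F i k \<omega>)" for k i \<omega>
  have S: "simple_function M (S k i)" for k i
    unfolding S_def by (rule simple_function_compose1[OF F(1)])
  have S_unim: "cmod (S k i \<omega>) = 1" for k i \<omega> by (simp add: S_def)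
  have S_m [measurable]: "S k i \<in> borel_measurable M" for k i
    by (rule borel_measurable_simple_function[OF S])
  have S_lim: "(\<lambda>k. S k i \<omega>) \<longlonglongrightarrow> s i \<omega>" if "\<omega> \<in> space M" for i \<omega>
  proof -
    have "s i \<omega> \<noteq> 0" using unim[of i \<omega>] by auto
    from tendsto_unit_phase[OF F(2)[OF that] this] show ?thesis
      by (simp add: S_def unit_phase_unimodular unim)
  qed
  define X where "X k = mat n n (\<lambda>(i, j). expectation (\<lambda>\<omega>. S k i \<omega> * cnj (S k j \<omega>)))" for k
  have X: "X k \<in> T" for k
  proof -
    define G where "G \<omega> = (\<lambda>i\<in>{..<n}. S k i \<omega>)" for \<omega>
    have G: "simple_function M G" unfolding G_def by (intro simple_function_restrict S) simp
    let ?Y = "G ` space M"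
    define p where "p y = prob (G -` {y} \<inter> space M)" for y
    \<comment> \<open>The phase leaves the values that are taken unchanged; it makes \<open>B y\<close> a generator for every \<open>y\<close>.\<close>
    define B where "B y = mat n n (\<lambda>(i, j). unit_phase (y i) * cnj (unit_phase (y j)))" for y
    have "mat n n (\<lambda>ij. \<Sum>y\<in>?Y. complex_of_real (p y) * B y $$ ij) \<in> T"
    proof (rule mat_convex_combination[OF T(2) Tc])
      show "finite ?Y" using G by (simp add: simple_function_def)
      show "B y \<in> T" for y
        using unimodular_outer_product_rank_one[OF n, of "\<lambda>i. unit_phase (y i)"] gen by (auto simp: B_def)
      show "sum p ?Y = 1"
        using expectation_simple_function[OF G, of "\<lambda>_. 1 :: real"] prob_space
        by (simp add: p_def has_bochner_integral_iff)
    qed (simp add: p_def)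
    also have "mat n n (\<lambda>ij. \<Sum>y\<in>?Y. complex_of_real (p y) * B y $$ ij) = X k"
    proof (rule eq_matI)
      fix i j assume "i < dim_row (X k)" "j < dim_col (X k)"
      then have ij: "i < n" "j < n" by (auto simp: X_def)
      have "expectation (\<lambda>\<omega>. S k i \<omega> * cnj (S k j \<omega>)) = (\<Sum>y\<in>?Y. p y *\<^sub>R (y i * cnj (y j)))"
        using expectation_simple_function[OF G, of "\<lambda>y. y i * cnj (y j)"] ij
        by (simp add: p_def G_def has_bochner_integral_iff)
      also have "\<dots> = (\<Sum>y\<in>?Y. complex_of_real (p y) * B y $$ (i, j))"
        using ij by (intro sum.cong) (auto simp: B_def G_def scaleR_conv_of_real unit_phase_unimodular S_unim)
      finally show "mat n n (\<lambda>ij. \<Sum>y\<in>?Y. complex_of_real (p y) * B y $$ ij) $$ (i, j) = X k $$ (i, j)"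
        using ij by (simp add: X_def)
    qed (auto simp: X_def)
    finally show ?thesis .
  qed
  show "mat n n (\<lambda>(i, j). expectation (\<lambda>\<omega>. s i \<omega> * cnj (s j \<omega>))) \<in> T"
  proof (rule closedin_mat_topology_sequentially[OF T(1) X])
    fix i j assume ij: "i < n" "j < n"
    have "(\<lambda>k. expectation (\<lambda>\<omega>. S k i \<omega> * cnj (S k j \<omega>))) \<longlonglongrightarrow> expectation (\<lambda>\<omega>. s i \<omega> * cnj (s j \<omega>))"
    proof (rule integral_dominated_convergence[where w="\<lambda>_. 1"])
      show "AE \<omega> in M. (\<lambda>k. S k i \<omega> * cnj (S k j \<omega>)) \<longlonglongrightarrow> s i \<omega> * cnj (s j \<omega>)"
        by (intro AE_I2 tendsto_intros S_lim)
    qed (auto simp: norm_mult S_unim intro!: borel_measurable_times measurable_compose[OF _ measurable_cnj])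
    then show "(\<lambda>k. X k $$ (i, j)) \<longlonglongrightarrow> mat n n (\<lambda>(i, j). expectation (\<lambda>\<omega>. s i \<omega> * cnj (s j \<omega>))) $$ (i, j)"
      using ij by (simp add: X_def)
  qed simp
qed

section \<open>The constant suffices\<close>

lemma hermitian_form_cong:
  "(\<And>i j. i < n \<Longrightarrow> j < n \<Longrightarrow> a i j = b i j) \<Longrightarrow> hermitian_form n a x = hermitian_form n b x"
  unfolding hermitian_form_def by (intro sum.cong) auto

lemma hermitian_form_add: "hermitian_form n (\<lambda>i j. a i j + b i j) x = hermitian_form n a x + hermitian_form n b x"
  by (simp add: hermitian_form_def sum.distrib algebra_simps)

lemma hermitian_form_diff: "hermitian_form n (\<lambda>i j. a i j - b i j) x = hermitian_form n a x - hermitian_form n b x"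
  by (simp add: hermitian_form_def sum_subtractf algebra_simps)

lemma hermitian_form_scale: "hermitian_form n (\<lambda>i j. c * a i j) x = c * hermitian_form n a x"
  by (simp add: hermitian_form_def sum_distrib_left algebra_simps)

lemma hermitian_form_diag:
  "hermitian_form n (\<lambda>i j. if i = j then e i else 0) x = (\<Sum>i<n. e i * of_real ((cmod (x i))\<^sup>2))"
proof -
  have "cnj (x i) * (if i = j then e i else 0) * x j = (if j = i then e i * of_real ((cmod (x i))\<^sup>2) else 0)" for i j
    by (simp only: complex_norm_square) simp
  then show ?thesis by (simp add: hermitian_form_def)
qed

lemma hermitian_form_gram:
  "hermitian_form n (\<lambda>i j. \<Sum>l<d. V i l * cnj (V j l)) x = of_real (\<Sum>l<d. (cmod (\<Sum>i<n. cnj (x i) * V i l))\<^sup>2)"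
proof -
  have "of_real (\<Sum>l<d. (cmod (\<Sum>i<n. cnj (x i) * V i l))\<^sup>2) =
      (\<Sum>l<d. \<Sum>i<n. \<Sum>j<n. cnj (x i) * V i l * (x j * cnj (V j l)))"
    unfolding of_real_sum complex_norm_square by (simp add: sum_product)
  also have "\<dots> = (\<Sum>i<n. \<Sum>j<n. \<Sum>l<d. cnj (x i) * V i l * (x j * cnj (V j l)))"
    by (subst sum.swap) (intro sum.cong refl sum.swap)
  also have "\<dots> = hermitian_form n (\<lambda>i j. \<Sum>l<d. V i l * cnj (V j l)) x"
    unfolding hermitian_form_def sum_distrib_left sum_distrib_right by (intro sum.cong refl) (simp add: mult_ac)
  finally show ?thesis by simp
qed

text \<open>
  The order between two diagonal matrices is the order between their entries.
\<close>

lemma D_set_iff: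
  "D \<in> D_set n \<longleftrightarrow> positive_semidef n D \<and> (\<forall>i<n. D $$ (i, i) \<le> 1)"
proof -
  have "loewner_le n (diag_part n D) (1\<^sub>m n) \<longleftrightarrow> (\<forall>i<n. D $$ (i, i) \<le> 1)"
  proof -
    define e where "e i = 1 - D $$ (i, i)" for i
    have form: "hermitian_form n (\<lambda>i j. (1\<^sub>m n - diag_part n D) $$ (i, j)) x = (\<Sum>i<n. e i * of_real ((cmod (x i))\<^sup>2))" for x
      unfolding hermitian_form_diag[symmetric]
      by (rule hermitian_form_cong) (simp add: diag_part_def mat_diag_def e_def)
    have "(\<forall>x. 0 \<le> (\<Sum>i<n. e i * of_real ((cmod (x i))\<^sup>2))) \<longleftrightarrow> (\<forall>i<n. 0 \<le> e i)"
    proof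
      assume l: "\<forall>x. 0 \<le> (\<Sum>i<n. e i * of_real ((cmod (x i))\<^sup>2))"
      show "\<forall>i<n. 0 \<le> e i"
      proof (intro allI impI)
        fix k assume "k < n"
        have "(\<Sum>i<n. e i * of_real ((cmod (if i = k then 1 else 0))\<^sup>2)) = (\<Sum>i<n. if i = k then e i else 0)"
          by (intro sum.cong) auto
        then show "0 \<le> e k" using spec[OF l, of "\<lambda>i. if i = k then 1 else 0"] \<open>k < n\<close> by simp
      qed
    next
      assume "\<forall>i<n. 0 \<le> e i"
      then show "\<forall>x. 0 \<le> (\<Sum>i<n. e i * of_real ((cmod (x i))\<^sup>2))"
        by (auto intro!: sum_nonneg simp: less_eq_complex_def)
    qed
    then show ?thesis
      unfolding loewner_le_def positive_semidef_iff form
      by (auto simp: diag_part_def mat_diag_def e_def)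
  qed
  then show ?thesis by (simp add: D_set_def)
qed

text \<open>
  Raising the diagonal of \<open>D\<close> to \<open>1\<close> only makes the task harder, and turns \<open>D\<close> into the Gram
  matrix of unit vectors \<open>V i\<close>. The matrix \<open>R\<close> is \<open>E s s\<^sup>*\<close> for the phases \<open>s i\<close> of the Gaussian
  variables \<open>z i\<close> belonging to \<open>V i\<close>. To compare the forms of \<open>R\<close> and \<open>D\<close> at \<open>x\<close>, let \<open>Y\<close> and
  \<open>W\<close> be the combinations of the phases and of the Gaussian variables with coefficients \<open>cnj (x i)\<close>.
  Then \<open>E |Y|\<^sup>2\<close> is the form of \<open>R\<close>, \<open>E |W|\<^sup>2\<close> is that of the raised matrix, and
  \<open>E Re (cnj Y W) = c E |W|\<^sup>2\<close> by the correlation with phases, so \<open>0 \<le> E |Y - c W|\<^sup>2\<close> says that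
  \<open>c\<^sup>2 E |W|\<^sup>2 \<le> E |Y|\<^sup>2\<close>, where \<open>c\<^sup>2 = \<pi>/4\<close>.
\<close>

lemma little_grothendieck:
  assumes n: "n \<ge> 1" and D: "D \<in> D_set n"
  shows "\<exists>R\<in>R_set n. loewner_le n D (complex_of_real (4 / pi) \<cdot>\<^sub>m R)"
proof -
  define c where "c = sqrt pi / 2"
  have c2: "c\<^sup>2 = pi / 4" by (simp add: c_def power_divide)
  have Dc: "D \<in> carrier_mat n n" and D0: "\<And>x. 0 \<le> hermitian_form n (\<lambda>i j. D $$ (i, j)) x"
    and D1: "\<And>i. i < n \<Longrightarrow> D $$ (i, i) \<le> 1"
    using D by (auto simp: D_set_iff positive_semidef_iff)
  define D' where "D' i j = D $$ (i, j) + (if i = j then 1 - D $$ (i, i) else 0)" for i j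
  have D'_form: "hermitian_form n (\<lambda>i j. D $$ (i, j)) x \<le> hermitian_form n D' x" for x
  proof -
    have "hermitian_form n D' x = hermitian_form n (\<lambda>i j. D $$ (i, j)) x + (\<Sum>i<n. (1 - D $$ (i, i)) * of_real ((cmod (x i))\<^sup>2))"
      unfolding hermitian_form_diag[symmetric] hermitian_form_add[symmetric] by (rule hermitian_form_cong) (simp add: D'_def)
    moreover have "0 \<le> (\<Sum>i<n. (1 - D $$ (i, i)) * of_real ((cmod (x i))\<^sup>2))"
      using D1 by (auto intro!: sum_nonneg simp: less_eq_complex_def)
    ultimately show ?thesis by simp
  qed
  have "0 \<le> hermitian_form n D' x" for x using D0 D'_form by (rule order_trans)
  then obtain V where V: "\<And>i j. i < n \<Longrightarrow> j < n \<Longrightarrow> D' i j = (\<Sum>l<n. V i l * cnj (V j l))"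
    using gram_decomposition by metis
  have unit: "l2norm n (V i) = 1" if "i < n" for i
  proof -
    have "complex_of_real ((l2norm n (V i))\<^sup>2) = D' i i"
      unfolding l2norm_square of_real_sum complex_norm_square V[OF that that] ..
    also have "\<dots> = 1" by (simp add: D'_def)
    finally have "(l2norm n (V i))\<^sup>2 = 1" using of_real_eq_1_iff by blast
    then show ?thesis by (simp add: power2_eq_1_iff) (smt (verit) L2_set_nonneg)
  qed
  define s where "s i \<omega> = unit_phase (gaussian_form n (V i) \<omega>)" for i \<omega>
  have s_m [measurable]: "s i \<in> borel_measurable gaussian_space" for i unfolding s_def by measurable
  have s_unim: "cmod (s i \<omega>) = 1" for i \<omega> by (simp add: s_def)
  define R where "R = mat n n (\<lambda>(i, j). \<integral>\<omega>. s i \<omega> * cnj (s j \<omega>) \<partial>gaussian_space)"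
  have Rc: "R \<in> carrier_mat n n" by (simp add: R_def)
  have "R \<in> R_set n"
    unfolding R_def using n s_m s_unim by (rule gauss.expectation_unimodular_in_R_set)
  moreover have "loewner_le n D (complex_of_real (4 / pi) \<cdot>\<^sub>m R)"
    unfolding loewner_le_def positive_semidef_iff
  proof (intro conjI allI)
    fix x :: "nat \<Rightarrow> complex"
    define w where "w l = (\<Sum>i<n. cnj (x i) * V i l)" for l
    define Y where "Y \<omega> = (\<Sum>i<n. cnj (x i) * s i \<omega>)" for \<omega>
    let ?W = "gaussian_form n w"
    have D'_w: "hermitian_form n D' x = of_real ((l2norm n w)\<^sup>2)"
    proof -
      have "hermitian_form n D' x = hermitian_form n (\<lambda>i j. \<Sum>l<n. V i l * cnj (V j l)) x"
        by (rule hermitian_form_cong) (rule V)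
      then show ?thesis unfolding hermitian_form_gram l2norm_square w_def .
    qed
    have RY: "has_bochner_integral gaussian_space (\<lambda>\<omega>. complex_of_real ((cmod (Y \<omega>))\<^sup>2)) (hermitian_form n (\<lambda>i j. R $$ (i, j)) x)"
    proof -
      have "has_bochner_integral gaussian_space (\<lambda>\<omega>. \<Sum>i<n. \<Sum>j<n. cnj (x i) * (s i \<omega> * cnj (s j \<omega>)) * x j)
          (\<Sum>i<n. \<Sum>j<n. cnj (x i) * (\<integral>\<omega>. s i \<omega> * cnj (s j \<omega>) \<partial>gaussian_space) * x j)"
        by (intro has_bochner_integral_sum has_bochner_integral_mult_left has_bochner_integral_mult_right
            has_bochner_integral_integrable gauss.integrable_unimodular_product s_m s_unim)
      moreover have "(\<Sum>i<n. \<Sum>j<n. cnj (x i) * (s i \<omega> * cnj (s j \<omega>)) * x j) = complex_of_real ((cmod (Y \<omega>))\<^sup>2)" for \<omega>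
        unfolding complex_norm_square Y_def cnj_sum sum_product by (intro sum.cong refl) (simp add: mult_ac)
      moreover have "(\<Sum>i<n. \<Sum>j<n. cnj (x i) * (\<integral>\<omega>. s i \<omega> * cnj (s j \<omega>) \<partial>gaussian_space) * x j) = hermitian_form n (\<lambda>i j. R $$ (i, j)) x"
        unfolding hermitian_form_def by (intro sum.cong refl) (simp add: R_def)
      ultimately show ?thesis by simp
    qed
    have YW: "has_bochner_integral gaussian_space (\<lambda>\<omega>. Re (cnj (Y \<omega>) * ?W \<omega>)) (c * (l2norm n w)\<^sup>2)"
    proof -
      have "has_bochner_integral gaussian_space (\<lambda>\<omega>. \<Sum>i<n. Re (cnj (s i \<omega>) * gaussian_form n (\<lambda>l. x i * w l) \<omega>))
          (\<Sum>i<n. sqrt pi / 2 * Re (\<Sum>l<n. x i * w l * cnj (V i l)))"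
        unfolding s_def using unit by (intro has_bochner_integral_sum gaussian_form_phase_correlation) simp
      moreover have "(\<Sum>i<n. Re (cnj (s i \<omega>) * gaussian_form n (\<lambda>l. x i * w l) \<omega>)) = Re (cnj (Y \<omega>) * ?W \<omega>)" for \<omega>
      proof -
        have "(\<Sum>i<n. cnj (s i \<omega>) * (x i * ?W \<omega>)) = cnj (Y \<omega>) * ?W \<omega>"
          unfolding Y_def cnj_sum sum_distrib_right by (intro sum.cong refl) simp
        then show ?thesis unfolding gaussian_form_scale Re_sum[symmetric] by simp
      qed
      moreover have "(\<Sum>i<n. sqrt pi / 2 * Re (\<Sum>l<n. x i * w l * cnj (V i l))) = c * (l2norm n w)\<^sup>2"
      proof -
        have "cnj (w l) = (\<Sum>i<n. x i * cnj (V i l))" for l by (simp add: w_def)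
        then have "(\<Sum>i<n. \<Sum>l<n. x i * w l * cnj (V i l)) = (\<Sum>l<n. w l * cnj (w l))"
          by (subst sum.swap) (simp add: sum_distrib_left mult_ac)
        also have "\<dots> = of_real ((l2norm n w)\<^sup>2)"
          unfolding l2norm_square of_real_sum complex_norm_square ..
        finally show ?thesis
          unfolding sum_distrib_left[symmetric] Re_sum[symmetric] c_def by simp
      qed
      ultimately show ?thesis by simp
    qed
    have le: "pi / 4 * (l2norm n w)\<^sup>2 \<le> Re (hermitian_form n (\<lambda>i j. R $$ (i, j)) x)"
    proof -
      have "2 * c * Re (cnj (Y \<omega>) * ?W \<omega>) - c\<^sup>2 * (cmod (?W \<omega>))\<^sup>2 \<le> (cmod (Y \<omega>))\<^sup>2" for \<omega>
      proof -
        have "0 \<le> (cmod (Y \<omega> - complex_of_real c * ?W \<omega>))\<^sup>2" by simp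
        also have "\<dots> = (cmod (Y \<omega>))\<^sup>2 - (2 * c * Re (cnj (Y \<omega>) * ?W \<omega>) - c\<^sup>2 * (cmod (?W \<omega>))\<^sup>2)"
          unfolding cmod_power2 by (simp add: power2_eq_square algebra_simps)
        finally show ?thesis by simp
      qed
      moreover have "has_bochner_integral gaussian_space (\<lambda>\<omega>. 2 * c * Re (cnj (Y \<omega>) * ?W \<omega>) - c\<^sup>2 * (cmod (?W \<omega>))\<^sup>2)
          (2 * c * (c * (l2norm n w)\<^sup>2) - c\<^sup>2 * (l2norm n w)\<^sup>2)"
        by (intro has_bochner_integral_diff has_bochner_integral_mult_right YW gaussian_form_square)
      moreover have "has_bochner_integral gaussian_space (\<lambda>\<omega>. (cmod (Y \<omega>))\<^sup>2) (Re (hermitian_form n (\<lambda>i j. R $$ (i, j)) x))"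
        using has_bochner_integral_Re[OF RY] by simp
      ultimately have "2 * c * (c * (l2norm n w)\<^sup>2) - c\<^sup>2 * (l2norm n w)\<^sup>2 \<le> Re (hermitian_form n (\<lambda>i j. R $$ (i, j)) x)"
        by (rule has_bochner_integral_mono[rotated 2])
      moreover have "2 * c * (c * (l2norm n w)\<^sup>2) - c\<^sup>2 * (l2norm n w)\<^sup>2 = pi / 4 * (l2norm n w)\<^sup>2"
        unfolding c2[symmetric] by (simp add: power2_eq_square)
      ultimately show ?thesis by simp
    qed
    have im: "Im (hermitian_form n (\<lambda>i j. R $$ (i, j)) x) = 0"
      using has_bochner_integral_Im[OF RY] by (auto simp: has_bochner_integral_iff)
    have "hermitian_form n (\<lambda>i j. (complex_of_real (4 / pi) \<cdot>\<^sub>m R - D) $$ (i, j)) x =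
        complex_of_real (4 / pi) * hermitian_form n (\<lambda>i j. R $$ (i, j)) x - hermitian_form n (\<lambda>i j. D $$ (i, j)) x"
      unfolding hermitian_form_scale[symmetric] hermitian_form_diff[symmetric]
      using Rc Dc by (intro hermitian_form_cong) auto
    moreover have "hermitian_form n (\<lambda>i j. D $$ (i, j)) x \<le> complex_of_real (4 / pi) * hermitian_form n (\<lambda>i j. R $$ (i, j)) x"
    proof (rule order_trans[OF D'_form])
      have "(l2norm n w)\<^sup>2 \<le> 4 / pi * Re (hermitian_form n (\<lambda>i j. R $$ (i, j)) x)"
        using mult_left_mono[OF le, of "4 / pi"] by simp
      then show "hermitian_form n D' x \<le> complex_of_real (4 / pi) * hermitian_form n (\<lambda>i j. R $$ (i, j)) x"
        unfolding D'_w less_eq_complex_def by (simp add: im)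
    qed
    ultimately show "0 \<le> hermitian_form n (\<lambda>i j. (complex_of_real (4 / pi) \<cdot>\<^sub>m R - D) $$ (i, j)) x"
      by simp
  qed (use Rc Dc in auto)
  ultimately show ?thesis by blast
qed

section \<open>No smaller constant suffices\<close>

lemma hermitian_form_rank_one:
  "hermitian_form n (\<lambda>i j. s i * cnj (s j)) x = of_real ((cmod (\<Sum>i<n. cnj (x i) * s i))\<^sup>2)"
  using hermitian_form_gram[of n "\<lambda>i _. s i" "Suc 0" x] by (simp add: lessThan_Suc)

text \<open>
  The left-hand side is a continuous linear functional of the matrix, so it is enough to bound it
  on the generators of the hull.
\<close>

lemma R_set_bound:
  fixes d :: nat
  assumes n: "n \<ge> 1"
    and bound: "\<And>s. (\<And>i. i < n \<Longrightarrow> cmod (s i) = 1) \<Longrightarrow> (\<Sum>l<d. (cmod (\<Sum>i<n. cnj (x l i) * s i))\<^sup>2) \<le> B"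
    and R: "R \<in> R_set n"
  shows "R \<in> carrier_mat n n" and "(\<Sum>l<d. Re (hermitian_form n (\<lambda>i j. R $$ (i, j)) (x l))) \<le> B"
proof -
  define \<Phi> where "\<Phi> A = (\<Sum>l<d. Re (hermitian_form n (\<lambda>i j. A $$ (i, j)) (x l)))" for A
  define T where "T = {A \<in> topspace (mat_topology n). \<Phi> A \<in> {..B}}"
  have top: "topspace (mat_topology n) = carrier_mat n n"
    by (auto simp: mat_topology_def topspace_pullback_topology PiE_iff)
  have "continuous_map (mat_topology n) euclidean (\<lambda>A. \<Sum>l<d. \<Sum>i<n. \<Sum>j<n. Re (cnj (x l i) * A $$ (i, j) * x l j))"
  proof (intro continuous_map_sum finite_lessThan)
    fix l i j assume ij: "i \<in> {..<n}" "j \<in> {..<n}"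
    have "continuous_map euclidean euclidean (\<lambda>z. Re (cnj (x l i) * z * x l j))"
      by (simp add: continuous_map_iff_continuous2) (intro continuous_intros)
    from continuous_map_compose[OF continuous_map_mat_entry this] ij
    show "continuous_map (mat_topology n) euclidean (\<lambda>A. Re (cnj (x l i) * A $$ (i, j) * x l j))"
      by (simp add: comp_def)
  qed
  then have "continuous_map (mat_topology n) euclidean \<Phi>"
    unfolding \<Phi>_def hermitian_form_def Re_sum .
  then have "closedin (mat_topology n) T"
    unfolding T_def by (rule closedin_continuous_map_preimage) simp
  moreover have "mat_convex T"
    unfolding mat_convex_def
  proof (intro ballI allI impI)
    fix A A' and u v :: real
    assume A: "A \<in> T" "A' \<in> T" and uv: "0 \<le> u" "0 \<le> v" "u + v = 1"
    let ?C = "complex_of_real u \<cdot>\<^sub>m A + complex_of_real v \<cdot>\<^sub>m A'"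
    have c: "A \<in> carrier_mat n n" "A' \<in> carrier_mat n n" using A by (auto simp: T_def top)
    have "hermitian_form n (\<lambda>i j. ?C $$ (i, j)) y =
        of_real u * hermitian_form n (\<lambda>i j. A $$ (i, j)) y + of_real v * hermitian_form n (\<lambda>i j. A' $$ (i, j)) y" for y
      unfolding hermitian_form_scale[symmetric] hermitian_form_add[symmetric]
      using c by (intro hermitian_form_cong) auto
    then have "\<Phi> ?C = u * \<Phi> A + v * \<Phi> A'"
      by (simp add: \<Phi>_def sum.distrib sum_distrib_left)
    also have "\<dots> \<le> B"
      using A uv by (intro convex_bound_le) (auto simp: T_def)
    finally show "?C \<in> T" using c by (simp add: T_def top)
  qed
  moreover have "A \<in> T" if A: "positive_semidef n A" "vec_space.rank n A = 1" "diag_part n A = 1\<^sub>m n" for A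
  proof -
    obtain s where s: "\<And>i. i < n \<Longrightarrow> cmod (s i) = 1"
      "\<And>i j. i < n \<Longrightarrow> j < n \<Longrightarrow> A $$ (i, j) = s i * cnj (s j)"
      using rank_one_unimodular[OF n A] by blast
    have "hermitian_form n (\<lambda>i j. A $$ (i, j)) y = of_real ((cmod (\<Sum>i<n. cnj (y i) * s i))\<^sup>2)" for y
      unfolding hermitian_form_rank_one[symmetric] by (rule hermitian_form_cong) (rule s)
    then have "\<Phi> A = (\<Sum>l<d. (cmod (\<Sum>i<n. cnj (x l i) * s i))\<^sup>2)"
      by (simp add: \<Phi>_def)
    then show ?thesis using bound[OF s(1)] A(1) by (simp add: T_def top positive_semidef_def)
  qed
  ultimately have "R_set n \<subseteq> T"
    unfolding R_set_def closed_convex_hull_def by (intro hull_minimal) auto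
  then show "R \<in> carrier_mat n n" and "(\<Sum>l<d. Re (hermitian_form n (\<lambda>i j. R $$ (i, j)) (x l))) \<le> B"
    using R by (auto simp: T_def top \<Phi>_def)
qed

text \<open>
  Let \<open>h i\<close> be the points of a discretized Gaussian vector in dimension \<open>d\<close>, with weights \<open>q i\<close>. The matrix \<open>D\<close> is
  the Gram matrix of the normalized points, and both sides of \<open>D \<le> k R\<close> are evaluated at the \<open>d\<close>
  vectors \<open>x l\<close> formed by the weighted \<open>l\<close>-th coordinates, and summed over \<open>l\<close>.
  For a rank one generator with phases \<open>s\<close>, the sum is the square of the length of
  \<open>\<Sum> q i s i h i\<close>. Tested against its own direction, this length is at most the mean modulus of
  a Gaussian variable, up to \<open>\<epsilon>\<close>. For \<open>D\<close>, the sum is the squared Hilbert-Schmidt norm of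
  \<open>\<Sum> q i h i h i\<^sup>* / |h i|\<close>, hence at least the squared trace divided by \<open>d\<close>, and the trace is the mean
  length of the points, close to \<open>\<surd>d\<close>.
\<close>

lemma dominating_constant_lower_bound:
  assumes k: "k > 0" "dominating_constant k" and d: "d \<ge> 1" and \<epsilon>: "\<epsilon> > 0"
    and large: "\<epsilon> \<le> sqrt d * (1 - 1 / (2 * real d))"
  shows "(sqrt d * (1 - 1 / (2 * real d)) - \<epsilon>)\<^sup>2 / d \<le> k * (sqrt pi / 2 + \<epsilon>)\<^sup>2"
proof -
  obtain Y p where Y: "finite Y" "\<And>y. p y \<ge> 0" "sum p Y = 1"
    and Y_le: "\<And>v. (\<Sum>y\<in>Y. p y * cmod (\<Sum>l<d. v l * y l)) \<le> (sqrt pi / 2 + \<epsilon>) * l2norm d v"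
    and Y_ge: "sqrt d * (1 - 1 / (2 * real d)) - \<epsilon> \<le> (\<Sum>y\<in>Y. p y * l2norm d y)"
    by (rule gaussian_discretization[OF d \<epsilon>]) (assumption | blast)+
  define n where "n = card Y"
  have "Y \<noteq> {}" using Y(3) by auto
  then have n: "n \<ge> 1" using Y(1) by (simp add: n_def Suc_le_eq card_gt_0_iff)
  obtain h where h: "bij_betw h {..<n} Y"
    using ex_bij_betw_nat_finite[OF Y(1)] by (auto simp: n_def lessThan_atLeast0)
  have reindex: "(\<Sum>y\<in>Y. f y) = (\<Sum>i<n. f (h i))" for f :: "(nat \<Rightarrow> complex) \<Rightarrow> real"
    by (rule sum.reindex_bij_betw[OF h, symmetric])
  define q where "q i = p (h i)" for i
  have q: "q i \<ge> 0" for i by (simp add: q_def Y)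
  \<comment> \<open>For \<open>h i = 0\<close> this is the zero vector, so the diagonal entry of \<open>D\<close> is \<open>0\<close> instead of \<open>1\<close>.\<close>
  define u where "u i l = h i l / of_real (l2norm d (h i))" for i l
  define C where "C = (sqrt pi / 2 + \<epsilon>)"
  have C: "C \<ge> 0" using \<epsilon> by (simp add: C_def)
  define D where "D = mat n n (\<lambda>(i, j). \<Sum>m<d. cnj (u i m) * u j m)"
  have D_form: "hermitian_form n (\<lambda>i j. D $$ (i, j)) x = of_real (\<Sum>m<d. (cmod (\<Sum>i<n. cnj (x i) * cnj (u i m)))\<^sup>2)" for x
    unfolding hermitian_form_gram[symmetric] by (rule hermitian_form_cong) (simp add: D_def)
  have "D \<in> D_set n"
    unfolding D_set_iff positive_semidef_iff
  proof (intro conjI allI impI)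
    show "0 \<le> hermitian_form n (\<lambda>i j. D $$ (i, j)) x" for x
      unfolding D_form less_eq_complex_def by (simp add: sum_nonneg)
    fix i assume "i < n"
    have "D $$ (i, i) = of_real ((l2norm d (u i))\<^sup>2)"
      unfolding l2norm_square of_real_sum complex_norm_square using \<open>i < n\<close> by (simp add: D_def mult.commute)
    also have "l2norm d (u i) = l2norm d (h i) / l2norm d (h i)"
    proof -
      have "l2norm d (u i) = l2norm d (\<lambda>l. inverse (of_real (l2norm d (h i))) * h i l)"
        by (simp add: u_def divide_inverse mult.commute)
      then show ?thesis unfolding l2norm_scale by (simp add: norm_inverse divide_inverse mult.commute)
    qed
    finally show "D $$ (i, i) \<le> 1" by (simp add: less_eq_complex_def)
  qed (simp add: D_def)
  then obtain R where R: "R \<in> R_set n" and DR: "loewner_le n D (complex_of_real k \<cdot>\<^sub>m R)"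
    using k(2) n unfolding dominating_constant_def by blast
  define x where "x l i = of_real (q i) * cnj (h i l)" for l i
  have "(\<Sum>l<d. (cmod (\<Sum>i<n. cnj (x l i) * s i))\<^sup>2) \<le> C\<^sup>2" if s: "\<And>i. i < n \<Longrightarrow> cmod (s i) = 1" for s
  proof -
    define X where "X l = (\<Sum>i<n. cnj (x l i) * s i)" for l
    have "of_real ((l2norm d X)\<^sup>2) = (\<Sum>l<d. cnj (X l) * X l)"
      unfolding l2norm_square of_real_sum complex_norm_square by (simp add: mult.commute)
    also have "\<dots> = (\<Sum>l<d. \<Sum>i<n. of_real (q i) * s i * (cnj (X l) * h i l))"
    proof (rule sum.cong)
      fix l
      have "cnj (X l) * X l = (\<Sum>i<n. cnj (X l) * (cnj (x l i) * s i))"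
        by (subst (2) X_def) (rule sum_distrib_left)
      then show "cnj (X l) * X l = (\<Sum>i<n. of_real (q i) * s i * (cnj (X l) * h i l))"
        by (simp add: x_def mult_ac)
    qed simp
    also have "\<dots> = (\<Sum>i<n. of_real (q i) * s i * (\<Sum>l<d. cnj (X l) * h i l))"
      by (subst sum.swap) (simp add: sum_distrib_left)
    finally have eq: "of_real ((l2norm d X)\<^sup>2) = (\<Sum>i<n. of_real (q i) * s i * (\<Sum>l<d. cnj (X l) * h i l))" .
    have "(l2norm d X)\<^sup>2 = cmod (\<Sum>i<n. of_real (q i) * s i * (\<Sum>l<d. cnj (X l) * h i l))"
      unfolding eq[symmetric] norm_of_real by simp
    also have "\<dots> \<le> (\<Sum>i<n. q i * cmod (\<Sum>l<d. cnj (X l) * h i l))"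
      by (rule sum_norm_le) (simp add: norm_mult s q)
    also have "\<dots> \<le> C * l2norm d (\<lambda>l. cnj (X l))"
      using Y_le[of "\<lambda>l. cnj (X l)"] unfolding reindex q_def C_def .
    finally have sq: "(l2norm d X)\<^sup>2 \<le> C * l2norm d X" by simp
    have "l2norm d X \<le> C"
    proof (cases "l2norm d X = 0")
      case False
      then have "0 < l2norm d X" by (simp add: order_less_le)
      then show ?thesis using sq by (simp add: power2_eq_square)
    qed (use C in simp)
    then have "(l2norm d X)\<^sup>2 \<le> C\<^sup>2" by (intro power_mono) auto
    then show ?thesis unfolding l2norm_square X_def .
  qed
  note R_bound = R_set_bound[OF n this R]
  have DR_form: "Re (hermitian_form n (\<lambda>i j. D $$ (i, j)) (x l)) \<le> k * Re (hermitian_form n (\<lambda>i j. R $$ (i, j)) (x l))" for l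
  proof -
    have "hermitian_form n (\<lambda>i j. (complex_of_real k \<cdot>\<^sub>m R - D) $$ (i, j)) (x l) =
        complex_of_real k * hermitian_form n (\<lambda>i j. R $$ (i, j)) (x l) - hermitian_form n (\<lambda>i j. D $$ (i, j)) (x l)"
      unfolding hermitian_form_scale[symmetric] hermitian_form_diff[symmetric]
      using R_bound(1) by (intro hermitian_form_cong) (auto simp: D_def)
    moreover have "0 \<le> hermitian_form n (\<lambda>i j. (complex_of_real k \<cdot>\<^sub>m R - D) $$ (i, j)) (x l)"
      using DR by (simp add: loewner_le_def positive_semidef_iff)
    ultimately show ?thesis by (simp add: less_eq_complex_def)
  qed
  define t where "t l = (\<Sum>i<n. q i * (cmod (h i l))\<^sup>2 / l2norm d (h i))" for l
  have t_le: "(t l)\<^sup>2 \<le> Re (hermitian_form n (\<lambda>i j. D $$ (i, j)) (x l))" if l: "l < d" for l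
  proof -
    have "(\<Sum>i<n. cnj (x l i) * cnj (u i l)) = of_real (t l)"
      unfolding t_def of_real_sum
      by (intro sum.cong refl)
        (simp only: of_real_mult of_real_divide complex_norm_square, simp add: x_def u_def mult_ac)
    then have "(t l)\<^sup>2 = (cmod (\<Sum>i<n. cnj (x l i) * cnj (u i l)))\<^sup>2" by simp
    also have "\<dots> \<le> (\<Sum>m<d. (cmod (\<Sum>i<n. cnj (x l i) * cnj (u i m)))\<^sup>2)"
      using l by (intro member_le_sum) auto
    finally show ?thesis unfolding D_form by simp
  qed
  have "(\<Sum>l<d. t l) = (\<Sum>i<n. q i * l2norm d (h i))"
  proof -
    have "(\<Sum>l<d. t l) = (\<Sum>i<n. q i * (l2norm d (h i))\<^sup>2 / l2norm d (h i))"
      unfolding t_def l2norm_square by (subst sum.swap) (simp add: sum_distrib_left sum_divide_distrib)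
    also have "\<dots> = (\<Sum>i<n. q i * l2norm d (h i))"
      by (intro sum.cong refl) (simp add: power2_eq_square)
    finally show ?thesis .
  qed
  then have "sqrt d * (1 - 1 / (2 * real d)) - \<epsilon> \<le> (\<Sum>l<d. t l)"
    using Y_ge unfolding reindex q_def by simp
  then have "(sqrt d * (1 - 1 / (2 * real d)) - \<epsilon>)\<^sup>2 \<le> (\<Sum>l<d. t l)\<^sup>2"
    using large by (intro power_mono) auto
  also have "\<dots> \<le> (\<Sum>l<d. (t l)\<^sup>2) * real d"
    using sum_squared_le_sum_of_squares[of t "{..<d}"] by simp
  also have "(\<Sum>l<d. (t l)\<^sup>2) \<le> (\<Sum>l<d. k * Re (hermitian_form n (\<lambda>i j. R $$ (i, j)) (x l)))"
    by (intro sum_mono order_trans[OF t_le DR_form]) simp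
  also have "\<dots> \<le> k * C\<^sup>2"
    unfolding sum_distrib_left[symmetric] using R_bound(2) k(1) by (intro mult_left_mono) auto
  finally have "(sqrt d * (1 - 1 / (2 * real d)) - \<epsilon>)\<^sup>2 \<le> k * C\<^sup>2 * real d"
    by (simp add: mult_right_mono)
  then show ?thesis using d by (subst pos_divide_le_eq) (simp_all add: C_def)
qed

theorem proposition1p2:
  shows "k_G_complex > 0 \<and> dominating_constant k_G_complex \<and>
    (\<forall>k::real. k > 0 \<and> dominating_constant k \<longrightarrow> k_G_complex \<le> k)"
proof (intro conjI allI impI)
  show "k_G_complex > 0" by (simp add: k_G_complex_def)
  show "dominating_constant k_G_complex"
    unfolding dominating_constant_def k_G_complex_def using little_grothendieck by blast
  fix k :: real assume k: "k > 0 \<and> dominating_constant k"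
  \<comment> \<open>With \<open>\<epsilon> = 1/d\<close>, the error of the discretization and the gap between mean length and \<open>\<surd>d\<close> vanish together.\<close>
  have "1 \<le> k * (sqrt pi / 2)\<^sup>2"
  proof (rule tendsto_le[OF trivial_limit_sequentially])
    show "(\<lambda>d. (sqrt (real d) * (1 - 1 / (2 * real d)) - 1 / real d)\<^sup>2 / real d) \<longlonglongrightarrow> 1"
      by real_asymp
    have "(\<lambda>d. 1 / real d) \<longlonglongrightarrow> 0" by real_asymp
    then have "(\<lambda>d. k * (sqrt pi / 2 + 1 / real d)\<^sup>2) \<longlonglongrightarrow> k * (sqrt pi / 2 + 0)\<^sup>2"
      by (intro tendsto_intros)
    then show "(\<lambda>d. k * (sqrt pi / 2 + 1 / real d)\<^sup>2) \<longlonglongrightarrow> k * (sqrt pi / 2)\<^sup>2"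
      by simp
    have "\<forall>\<^sub>F d in sequentially. 1 / real d \<le> sqrt (real d) * (1 - 1 / (2 * real d))"
      by real_asymp
    then show "\<forall>\<^sub>F d in sequentially. (sqrt (real d) * (1 - 1 / (2 * real d)) - 1 / real d)\<^sup>2 / real d
        \<le> k * (sqrt pi / 2 + 1 / real d)\<^sup>2"
      using eventually_gt_at_top[of 0]
    proof eventually_elim
      case (elim d)
      then show ?case using k by (intro dominating_constant_lower_bound) auto
    qed
  qed
  then show "k_G_complex \<le> k"
    by (simp add: k_G_complex_def power_divide field_simps)
qed

end
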